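(* Let $n\ge2$. There are constants $c_1,c_2>0$ such that for every $u\in d^{n-1}(\mathbb{R}^n)\cap C(\mathbb{R}^n)$, $$c_1\|u\|_*\le\|u\|_{d^{n-1}}\le c_2\|u\|_*.$$
   Context: Notation: $\mathcal{D}(\mathbb{R}^n)$ is the space of compactly supported smooth functions, $\mathcal{D}'(\mathbb{R}^n)$ the space of distributions, and $\mathcal{D}^k(\mathbb{R}^n)$ the space of $k$-differential forms $\Phi=\sum_{|I|=k}\phi_I\,dx^I$ (sum over increasing multi-indices) with $\phi_I\in\mathcal{D}(\mathbb{R}^n)$. For such a form, $\|\Phi\|_{L^1_k}=\sum_{|I|=k}\|\phi_I\|_{L^1}$ and $\|\Phi\|_{\Upsilon^1_k(\mathbb{R}^n)}=\|\Phi\|_{L^1_k}+\|d\Phi\|_{L^1_{k+1}}$, where $d$ is the exterior derivative. For $1\le k\le n$, $d^k(\mathbb{R}^n)$ is the space of $u\in\mathcal{D}'(\mathbb{R}^n)$ with $$\|u\|_{d^k}:=\sup\Big\{\max_{|I|=k}|u(\phi_I)| : \Phi\in\mathcal{D}^k(\mathbb{R}^n),\ \|\Phi\|_{\Upsilon^1_k(\mathbb{R}^n)}\le 1\Big\}<\infty.$$ $C(\mathbb{R}^n)$ is the space of continuous functions, identified with distributions. For such $u$, $$\|u\|_*=\sup_{\partial\gamma=\emptyset}\frac1{|\gamma|}\left|\int_\gamma u(t)\tau(t)\,dt\right|+\sup_{|\gamma|\ge 1}\frac1{|\gamma|}\left|\int_\gamma u(t)\tau(t)\,dt\right|,$$ where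 the suprema are taken over smooth curves $\gamma$ in $\mathbb{R}^n$ with finite length $|\gamma|$, boundary $\partial\gamma$ (so $\partial\gamma=\emptyset$ means $\gamma$ is closed) and unit tangent vector $\tau$; the integrals are $\mathbb{R}^n$-valued, with respect to arc length. *)

theory Defs
  imports "HOL-Analysis.Analysis"
begin

text \<open>
  All functions are real valued. The class constraint \<open>'n::{finite,linorder}\<close> supplies the order of
  the coordinates, which fixes the signs in the exterior derivative.
\<close>

section \<open>Smooth functions, test functions and distributions\<close>

fun times_differentiable :: "nat \<Rightarrow> ('a::real_normed_vector \<Rightarrow> 'b::real_normed_vector) \<Rightarrow> bool"
  where
    "times_differentiable 0 f \<longleftrightarrow> continuous_on UNIV f"
  | "times_differentiable (Suc m) f \<longleftrightarrow>
       (\<forall>x. f differentiable (at x)) \<and>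
       (\<forall>v. times_differentiable m (\<lambda>x. frechet_derivative f (at x) v))"

definition smooth :: "('a::real_normed_vector \<Rightarrow> 'b::real_normed_vector) \<Rightarrow> bool"
  where "smooth f \<longleftrightarrow> (\<forall>m. times_differentiable m f)"

definition supp :: "('a::topological_space \<Rightarrow> real) \<Rightarrow> 'a set"
  where "supp \<phi> = closure {x. \<phi> x \<noteq> 0}"

definition test_functions :: "(real^'n \<Rightarrow> real) set"
  where "test_functions = {\<phi>. smooth \<phi> \<and> compact (supp \<phi>)}"

definition partial_deriv :: "'n::finite \<Rightarrow> (real^'n \<Rightarrow> real) \<Rightarrow> real^'n \<Rightarrow> real"
  where "partial_deriv i f = (\<lambda>x. frechet_derivative f (at x) (axis i 1))"

definition iterated_partial :: "'n::finite list \<Rightarrow> (real^'n \<Rightarrow> real) \<Rightarrow> real^'n \<Rightarrow> real"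
  where "iterated_partial is f = foldr partial_deriv is f"

text \<open>
  A distribution is a functional on test functions; its values at other functions are irrelevant.
  Continuity for the usual inductive limit topology is expressed by the seminorm estimates on
  the test functions supported in a given compact set.
\<close>

definition distribution :: "((real^'n \<Rightarrow> real) \<Rightarrow> real) \<Rightarrow> bool"
  where "distribution T \<longleftrightarrow>
    (\<forall>\<phi>\<in>test_functions. \<forall>\<psi>\<in>test_functions. T (\<lambda>x. \<phi> x + \<psi> x) = T \<phi> + T \<psi>) \<and>
    (\<forall>c. \<forall>\<phi>\<in>test_functions. T (\<lambda>x. c * \<phi> x) = c * T \<phi>) \<and>
    (\<forall>K. compact K \<longrightarrow>
      (\<exists>N C. \<forall>\<phi>\<in>test_functions. supp \<phi> \<subseteq> K \<longrightarrow>
        \<bar>T \<phi>\<bar> \<le> C * (\<Sum>is | length is \<le> N. SUP x. \<bar>iterated_partial is \<phi> x\<bar>)))"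

definition distribution_of :: "(real^'n \<Rightarrow> real) \<Rightarrow> (real^'n \<Rightarrow> real) \<Rightarrow> real"
  where "distribution_of u \<phi> = (\<integral>x. u x * \<phi> x \<partial>lborel)"

section \<open>Differential forms and the spaces \<open>d\<^sup>k\<close>\<close>

text \<open>
  An increasing multi-index of length \<open>k\<close> is represented by the set of its entries, a \<open>k\<close>-element
  set of coordinates. A \<open>k\<close>-form is represented by its coefficient family \<open>\<Phi>\<close>, of which only the
  coefficients \<open>\<Phi> I\<close> with \<open>card I = k\<close> matter.
\<close>

type_synonym 'n form = "'n set \<Rightarrow> (real, 'n) vec \<Rightarrow> real"

definition multi_indices :: "nat \<Rightarrow> 'n::finite set set"
  where "multi_indices k = {I. card I = k}"

definition test_forms :: "nat \<Rightarrow> 'n::finite form set"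
  where "test_forms k = {\<Phi>. \<forall>I\<in>multi_indices k. \<Phi> I \<in> test_functions}"

text \<open>
  \<open>dx\<^sup>j \<and> dx\<^sup>I = (-1)\<^sup>m dx\<^sup>J\<close> for \<open>j \<notin> I\<close> and \<open>J = I \<union> {j}\<close>, where \<open>m\<close> is the number of elements of \<open>I\<close>
  below \<open>j\<close>.
\<close>

definition ext_deriv :: "'n::{finite,linorder} form \<Rightarrow> 'n form"
  where "ext_deriv \<Phi> J =
    (\<lambda>x. \<Sum>j\<in>J. (-1) ^ card {i\<in>J. i < j} * partial_deriv j (\<Phi> (J - {j})) x)"

definition L1_norm :: "nat \<Rightarrow> 'n::finite form \<Rightarrow> real"
  where "L1_norm k \<Phi> = (\<Sum>I\<in>multi_indices k. \<integral>x. \<bar>\<Phi> I x\<bar> \<partial>lborel)"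

definition Upsilon1_norm :: "nat \<Rightarrow> 'n::{finite,linorder} form \<Rightarrow> real"
  where "Upsilon1_norm k \<Phi> = L1_norm k \<Phi> + L1_norm (k + 1) (ext_deriv \<Phi>)"

definition d_norm :: "nat \<Rightarrow> ((real^'n::{finite,linorder} \<Rightarrow> real) \<Rightarrow> real) \<Rightarrow> ennreal"
  where "d_norm k T =
    (SUP \<Phi>\<in>{\<Phi>\<in>test_forms k. Upsilon1_norm k \<Phi> \<le> 1}.
       ennreal (Max ((\<lambda>I. \<bar>T (\<Phi> I)\<bar>) ` multi_indices k)))"

definition d_space :: "nat \<Rightarrow> ((real^'n::{finite,linorder} \<Rightarrow> real) \<Rightarrow> real) set"
  where "d_space k = {T. distribution T \<and> d_norm k T < \<infinity>}"

section \<open>Integrals along smooth curves\<close>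

definition velocity :: "(real \<Rightarrow> real^'n) \<Rightarrow> real \<Rightarrow> real^'n"
  where "velocity \<gamma> = (\<lambda>t. vector_derivative \<gamma> (at t))"

text \<open>
  Curves are regular (so that the unit tangent exists) and are parametrised by a compact interval;
  being smooth on \<open>{a..b}\<close> means being the restriction of a function that is smooth on the real line.
  Self-intersections are allowed. A curve is closed, i.e. has empty boundary, if it is the image of
  a smoothly immersed circle: the derivatives of all orders agree at the two end points.
\<close>

definition smooth_curve :: "(real \<Rightarrow> real^'n) \<Rightarrow> real \<Rightarrow> real \<Rightarrow> bool"
  where "smooth_curve \<gamma> a b \<longleftrightarrow> a < b \<and> smooth \<gamma> \<and> (\<forall>t\<in>{a..b}. velocity \<gamma> t \<noteq> 0)"

definition smooth_closed_curve :: "(real \<Rightarrow> real^'n) \<Rightarrow> real \<Rightarrow> real \<Rightarrow> bool"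
  where "smooth_closed_curve \<gamma> a b \<longleftrightarrow>
    smooth_curve \<gamma> a b \<and> (\<forall>m. (velocity ^^ m) \<gamma> a = (velocity ^^ m) \<gamma> b)"

definition curve_length :: "(real \<Rightarrow> real^'n) \<Rightarrow> real \<Rightarrow> real \<Rightarrow> real"
  where "curve_length \<gamma> a b = integral {a..b} (\<lambda>t. norm (velocity \<gamma> t))"

definition unit_tangent :: "(real \<Rightarrow> real^'n) \<Rightarrow> real \<Rightarrow> real^'n"
  where "unit_tangent \<gamma> t = velocity \<gamma> t /\<^sub>R norm (velocity \<gamma> t)"

text \<open>The factor \<open>norm (velocity \<gamma> t)\<close> is the arc length element.\<close>

definition tangent_integral ::
    "(real^'n \<Rightarrow> real) \<Rightarrow> (real \<Rightarrow> real^'n) \<Rightarrow> real \<Rightarrow> real \<Rightarrow> real^'n"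
  where "tangent_integral u \<gamma> a b =
    integral {a..b} (\<lambda>t. norm (velocity \<gamma> t) *\<^sub>R (u (\<gamma> t) *\<^sub>R unit_tangent \<gamma> t))"

definition curve_average :: "(real^'n \<Rightarrow> real) \<Rightarrow> (real \<Rightarrow> real^'n) \<Rightarrow> real \<Rightarrow> real \<Rightarrow> real"
  where "curve_average u \<gamma> a b = norm (tangent_integral u \<gamma> a b) / curve_length \<gamma> a b"

definition star_norm :: "(real^'n \<Rightarrow> real) \<Rightarrow> ennreal"
  where "star_norm u =
    (SUP (\<gamma>, a, b)\<in>{(\<gamma>, a, b). smooth_closed_curve \<gamma> a b}. ennreal (curve_average u \<gamma> a b)) +
    (SUP (\<gamma>, a, b)\<in>{(\<gamma>, a, b). smooth_curve \<gamma> a b \<and> curve_length \<gamma> a b \<ge> 1}.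
       ennreal (curve_average u \<gamma> a b))"

end

(*
  A form of degree n - 1 is a vector field V, and its exterior derivative is the divergence.

  star norm <= C d^{n-1} norm: mollifying the tangential measure of a curve gives a field V whose
  L^1 norm is at most the length and whose divergence is the difference of two bumps at the end
  points; testing u against V approximates the curve integral.

  d^{n-1} norm <= 4 star norm: let M bound the averages over curves of length at least 1, and let
  p(y) be the infimum, over the curves ending at y, of the j-th component of the curve integral of
  u plus M times the length. Then -4M <= p <= 0, and since curves can be prolonged by segments, p
  is a potential of u e_j up to an error field of sup norm at most M. Integrating by parts, the
  integral of u V_j is at most M times the L^1 norm of V plus 4M times that of div V.
*)

theory Submission
  imports Defs
begin

section \<open>Smooth functions\<close>

text \<open>The two suprema in the star norm mirror two kinds of current. A closed curve gives a
  divergence-free field, so it may be arbitrarily short; for any other curve the divergence can have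
  mass 2, which the length absorbs only if it is bounded below. The obstacle in the second
  inequality is smoothness. The potential is built by prolonging curves, but the star norm sees only
  smooth regular ones, and a joint would create a corner. So the curves come to rest at the joints,
  which keeps them smooth but destroys regularity; a small perturbation restores it, and this is
  where n >= 2 enters. The constant 4 arises because curves of length below 1 carry no bound: a
  curve of length l and the trivial curve are both prolonged by the same segment of length 2, and
  the comparison costs M (l + 2) + 2 M, of which M l is already paid for in the infimum. An infimum
  need not be differentiable, so the integration by parts is carried out on difference
  quotients.\<close>

text \<open>As derivatives are unique, an explicit \<open>D\<close> can replace the one picked by
  \<open>frechet_derivative\<close>; the inductions below can then work with formulas.\<close>

lemma times_differentiable_SucI:
  assumes "\<And>x. (f has_derivative D x) (at x)" "\<And>v. times_differentiable m (\<lambda>x. D x v)"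
  shows "times_differentiable (Suc m) f"
proof -
  have "frechet_derivative f (at x) = D x" for x
    using assms(1) by (metis frechet_derivative_at)
  then show ?thesis
    using assms by (auto simp: differentiable_def)
qed

lemma times_differentiable_SucD:
  "times_differentiable (Suc m) f \<Longrightarrow> times_differentiable m f"
proof (induction m arbitrary: f)
  case 0
  then show ?case
    by (auto intro!: continuous_at_imp_continuous_on differentiable_imp_continuous_within)
next
  case (Suc m)
  then show ?case by (metis times_differentiable.simps(2))
qed

lemma times_differentiable_has_derivative:
  assumes "times_differentiable (Suc m) f"
  shows "(f has_derivative frechet_derivative f (at x)) (at x)"
  using assms by (auto simp: frechet_derivative_works)

lemma times_differentiable_continuous: "times_differentiable m f \<Longrightarrow> continuous_on UNIV f"
  by (induction m) (auto dest: times_differentiable_SucD simp del: times_differentiable.simps(2))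

lemma times_differentiable_const [simp]: "times_differentiable m (\<lambda>x. c)"
proof (induction m arbitrary: c)
  case (Suc m)
  then show ?case
    by (intro times_differentiable_SucI[of _ "\<lambda>x v. 0"]) auto
qed auto

lemma times_differentiable_add:
  "times_differentiable m f \<Longrightarrow> times_differentiable m g \<Longrightarrow> times_differentiable m (\<lambda>x. f x + g x)"
proof (induction m arbitrary: f g)
  case 0
  then show ?case by (auto intro: continuous_intros)
next
  case (Suc m)
  show ?case
    by (rule times_differentiable_SucI, rule has_derivative_add,
        rule times_differentiable_has_derivative[OF Suc.prems(1)],
        rule times_differentiable_has_derivative[OF Suc.prems(2)], rule Suc.IH)
       (use Suc.prems in auto)
qed

text \<open>The product rule gives two further values of \<open>B\<close>. In each, one factor is
  differentiated and the other merely gives up one order, so the induction ranges over all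
  pairs.\<close>

lemma times_differentiable_bilinear:
  assumes B: "bounded_bilinear B"
  shows "times_differentiable m f \<Longrightarrow> times_differentiable m g \<Longrightarrow> times_differentiable m (\<lambda>x. B (f x) (g x))"
proof (induction m arbitrary: f g)
  case 0
  then show ?case using bounded_bilinear.continuous_on[OF B] by auto
next
  case (Suc m)
  note td = Suc.prems[THEN times_differentiable_SucD]
  show ?case
    by (rule times_differentiable_SucI, rule bounded_bilinear.FDERIV[OF B],
        rule times_differentiable_has_derivative[OF Suc.prems(1)],
        rule times_differentiable_has_derivative[OF Suc.prems(2)],
        rule times_differentiable_add; rule Suc.IH)
       (use Suc.prems td in auto)
qed

lemma times_differentiable_linear:
  assumes "bounded_linear f" shows "times_differentiable m f"
proof (cases m)
  case 0
  then show ?thesis using assms by (auto intro: linear_continuous_on)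
next
  case (Suc k)
  then show ?thesis using assms
    by (auto intro!: times_differentiable_SucI[of _ "\<lambda>x. f"] bounded_linear_imp_has_derivative
        simp del: times_differentiable.simps)
qed

text \<open>The outer function has a real argument, so its derivative is determined by the value at
  1. The chain rule then produces a scalar multiple of another composition, to which the bilinear
  case and the induction hypothesis apply.\<close>

lemma times_differentiable_real_compose:
  fixes f :: "real \<Rightarrow> 'b::real_normed_vector" and g :: "'a::real_normed_vector \<Rightarrow> real"
  shows "times_differentiable m f \<Longrightarrow> times_differentiable m g \<Longrightarrow> times_differentiable m (\<lambda>x. f (g x))"
proof (induction m arbitrary: f g)
  case 0
  then show ?case by (auto intro: continuous_on_compose2)
next
  case (Suc m)
  have "((\<lambda>x. f (g x)) has_derivative
          (\<lambda>v. frechet_derivative g (at x) v *\<^sub>R frechet_derivative f (at (g x)) 1)) (at x)" for x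
  proof -
    note df = times_differentiable_has_derivative[OF Suc.prems(1), of "g x"]
    note dg = times_differentiable_has_derivative[OF Suc.prems(2), of x]
    interpret bounded_linear "frechet_derivative f (at (g x))"
      using df by (rule has_derivative_bounded_linear)
    have "frechet_derivative f (at (g x)) h = h *\<^sub>R frechet_derivative f (at (g x)) 1" for h
      using scaleR[of h 1] by simp
    then show ?thesis
      by (intro has_derivative_eq_rhs[OF has_derivative_compose[OF dg df]] ext)
  qed
  moreover have "times_differentiable m
     (\<lambda>x. frechet_derivative g (at x) v *\<^sub>R frechet_derivative f (at (g x)) 1)" for v
    using Suc.prems times_differentiable_SucD[OF Suc.prems(2)]
    by (intro times_differentiable_bilinear[OF bounded_bilinear_scaleR]
        Suc.IH[of "\<lambda>t. frechet_derivative f (at t) 1" g]) auto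
  ultimately show ?case by (rule times_differentiable_SucI)
qed

section \<open>Closure properties of smooth functions\<close>

lemma smooth_continuous: "smooth f \<Longrightarrow> continuous_on UNIV f"
  unfolding smooth_def by (metis times_differentiable_continuous)

lemma smooth_has_derivative: "smooth f \<Longrightarrow> (f has_derivative frechet_derivative f (at x)) (at x)"
  unfolding smooth_def by (metis times_differentiable_has_derivative)

lemma smooth_frechet_derivative: "smooth f \<Longrightarrow> smooth (\<lambda>x. frechet_derivative f (at x) v)"
  unfolding smooth_def by (metis times_differentiable.simps(2))

lemma smooth_const [simp]: "smooth (\<lambda>x. c)"
  by (simp add: smooth_def)

lemma smooth_add: "smooth f \<Longrightarrow> smooth g \<Longrightarrow> smooth (\<lambda>x. f x + g x)"
  by (simp add: smooth_def times_differentiable_add)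

lemma smooth_scaleR: "smooth f \<Longrightarrow> smooth g \<Longrightarrow> smooth (\<lambda>x. f x *\<^sub>R g x)"
  by (simp add: smooth_def times_differentiable_bilinear[OF bounded_bilinear_scaleR])

lemma smooth_mult:
  fixes f g :: "'a::real_normed_vector \<Rightarrow> real"
  shows "smooth f \<Longrightarrow> smooth g \<Longrightarrow> smooth (\<lambda>x. f x * g x)"
  using smooth_scaleR[of f g] by simp

lemma smooth_linear: "bounded_linear f \<Longrightarrow> smooth f"
  by (simp add: smooth_def times_differentiable_linear)

lemma smooth_real_compose:
  fixes f :: "real \<Rightarrow> 'b::real_normed_vector"
  shows "smooth f \<Longrightarrow> smooth g \<Longrightarrow> smooth (\<lambda>x. f (g x))"
  by (simp add: smooth_def times_differentiable_real_compose)

lemma smooth_inner_self: "smooth (\<lambda>x::'a::real_inner. x \<bullet> x)"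
  unfolding smooth_def
  by (intro allI times_differentiable_bilinear[OF bounded_bilinear_inner]
      times_differentiable_linear bounded_linear_ident)

section \<open>Velocities of smooth curves\<close>

lemma smooth_velocity:
  assumes "smooth \<gamma>"
  shows "(\<gamma> has_vector_derivative velocity \<gamma> t) (at t)" and "smooth (velocity \<gamma>)"
proof -
  have *: "(\<gamma> has_vector_derivative frechet_derivative \<gamma> (at t) 1) (at t)" for t
  proof -
    note d = smooth_has_derivative[OF assms, of t]
    interpret bounded_linear "frechet_derivative \<gamma> (at t)"
      using d by (rule has_derivative_bounded_linear)
    have "frechet_derivative \<gamma> (at t) h = h *\<^sub>R frechet_derivative \<gamma> (at t) 1" for h
      using scaleR[of h 1] by simp
    then show ?thesis unfolding has_vector_derivative_def
      by (intro has_derivative_eq_rhs[OF d] ext)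
  qed
  then have v: "velocity \<gamma> = (\<lambda>t. frechet_derivative \<gamma> (at t) 1)"
    unfolding velocity_def by (auto intro!: vector_derivative_at)
  show "(\<gamma> has_vector_derivative velocity \<gamma> t) (at t)" using * v by simp
  show "smooth (velocity \<gamma>)" unfolding v using assms by (rule smooth_frechet_derivative)
qed

lemma velocity_eqI:
  "(\<And>t. (\<gamma> has_vector_derivative v t) (at t)) \<Longrightarrow> velocity \<gamma> = v"
  unfolding velocity_def by (auto intro!: vector_derivative_at)

section \<open>Cut-off functions\<close>

text \<open>Differentiating exp (-1/t) produces powers of 1/t. With these built in, the family is
  closed under differentiation up to linear combinations, so one induction over all \<open>k\<close>
  gives smoothness.\<close>

definition flat_exp :: "nat \<Rightarrow> real \<Rightarrow> real"
  where "flat_exp k t = (if t > 0 then exp (- 1 / t) / t ^ k else 0)"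

text \<open>On the right of 0, the substitution t = 1/x turns the quotient into x^k / exp x at
  infinity.\<close>

lemma flat_exp_tendsto_0: "(flat_exp k \<longlongrightarrow> 0) (at 0)"
proof -
  have "((\<lambda>x::real. x ^ k / exp x) \<longlongrightarrow> 0) at_top"
    by (rule tendsto_power_div_exp_0)
  then have "((\<lambda>t::real. (inverse t) ^ k / exp (inverse t)) \<longlongrightarrow> 0) (at_right 0)"
    using filterlim_compose filterlim_inverse_at_top_right by blast
  then have "(flat_exp k \<longlongrightarrow> 0) (at_right 0)"
  proof (rule Lim_transform_eventually)
    show "\<forall>\<^sub>F t in at_right 0. inverse t ^ k / exp (inverse t) = flat_exp k t"
      unfolding eventually_at_right_field
      by (auto intro!: exI[of _ 1] simp: flat_exp_def exp_minus field_simps)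
  qed
  moreover have "(flat_exp k \<longlongrightarrow> 0) (at_left 0)"
    by (rule Lim_transform_eventually[OF tendsto_const])
       (auto simp: flat_exp_def eventually_at_left_field intro!: exI[of _ "-1"])
  ultimately show ?thesis by (simp add: filterlim_split_at)
qed

lemma flat_exp_has_derivative:
  "(flat_exp k has_real_derivative (flat_exp (k + 2) t - k * flat_exp (k + 1) t)) (at t)"
proof -
  consider "t > 0" | "t < 0" | "t = 0" by linarith
  then show ?thesis
  proof cases
    case 1
    have "((\<lambda>t. exp (- 1 / t) / t ^ k) has_real_derivative
            (flat_exp (k + 2) t - k * flat_exp (k + 1) t)) (at t)"
    proof -
      \<comment> \<open>Writing the derivative as \<open>k * t ^ k / t\<close> avoids the truncated
        exponent \<open>k - 1\<close>.\<close>
      have "((\<lambda>t. t ^ k) has_real_derivative (k * t ^ k / t)) (at t)"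
        using DERIV_pow[of k t] 1 by (cases k) auto
      moreover have "((\<lambda>t. exp (- 1 / t)) has_real_derivative (exp (- 1 / t) / (t * t))) (at t)"
        using 1 by (auto intro!: derivative_eq_intros)
      ultimately show ?thesis
        using 1 by (intro DERIV_cong[OF DERIV_divide]) (auto simp: flat_exp_def divide_simps algebra_simps)
    qed
    then show ?thesis
      by (rule DERIV_cong_ev[THEN iffD1, rotated -1, OF _ refl _ refl])
         (use 1 in \<open>auto simp: flat_exp_def eventually_nhds intro!: exI[of _ "{0<..}"]\<close>)
  next
    case 2
    have "((\<lambda>t. 0) has_real_derivative 0) (at t)" by simp
    then show ?thesis
      by (rule DERIV_cong_ev[THEN iffD1, rotated -1, OF _ refl _ ])
         (use 2 in \<open>auto simp: flat_exp_def eventually_nhds intro!: exI[of _ "{..<0}"]\<close>)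
  next
    case 3
    \<comment> \<open>Dividing by \<open>h\<close> raises the exponent by one, so the derivative at
      0 is the limit of the next member of the family. At h = 0 both sides are 0, because x / 0 =
      0.\<close>
    have "(\<lambda>h. (flat_exp k (0 + h) - flat_exp k 0) / h) = flat_exp (Suc k)"
      by (auto simp: flat_exp_def field_simps fun_eq_iff)
    then show ?thesis
      using flat_exp_tendsto_0[of "Suc k"] 3 unfolding DERIV_def
      by (simp add: flat_exp_def)
  qed
qed

lemma smooth_flat_exp: "smooth (flat_exp k)"
proof -
  have "times_differentiable m (flat_exp k)" for m
  proof (induction m arbitrary: k)
    case 0
    then show ?case
      using flat_exp_has_derivative by (auto intro!: continuous_at_imp_continuous_on DERIV_isCont)
  next
    case (Suc m)
    show ?case
    proof (rule times_differentiable_SucI)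
      show "(flat_exp k has_derivative
              (\<lambda>h. (flat_exp (k + 2) x + (- real k) * flat_exp (k + 1) x) * h)) (at x)" for x
        using flat_exp_has_derivative[of k x] by (simp add: has_field_derivative_def)
      show "times_differentiable m
              (\<lambda>x. (flat_exp (k + 2) x + (- real k) * flat_exp (k + 1) x) * v)" for v
        using Suc.IH
        by (intro times_differentiable_bilinear[OF bounded_bilinear_mult] times_differentiable_add) auto
    qed
  qed
  then show ?thesis by (simp add: smooth_def)
qed

lemma smooth_affine: "smooth (\<lambda>t::real. a * t + b)"
  by (intro smooth_add smooth_linear bounded_linear_mult_right smooth_const)

text \<open>A normalised primitive of a bump on [0,1]. Used as a time change, it lets a motion start
  and stop smoothly from rest; the sign of \<open>s'\<close> keeps the motion monotone, so that no
  length is added.\<close>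

lemma exists_smooth_step:
  obtains s s' :: "real \<Rightarrow> real" where
    "smooth s" "\<And>t. t \<le> 0 \<Longrightarrow> s t = 0" "\<And>t. t \<ge> 1 \<Longrightarrow> s t = 1"
    "\<And>t. (s has_real_derivative s' t) (at t)" "\<And>t. s' t \<ge> 0" "continuous_on UNIV s'"
    "\<And>t. t \<le> 0 \<or> t \<ge> 1 \<Longrightarrow> s' t = 0"
proof -
  define g where "g t = flat_exp 0 t * flat_exp 0 (-1 * t + 1)" for t
  have sg: "smooth g"
    unfolding g_def
    by (intro smooth_mult smooth_flat_exp smooth_real_compose[OF smooth_flat_exp] smooth_affine)
  have cg: "continuous_on A g" for A
    using smooth_continuous[OF sg] continuous_on_subset by blast
  have ig: "g integrable_on {a..b}" for a b
    using cg by (rule integrable_continuous_interval)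
  have g0: "g t \<ge> 0" for t by (simp add: g_def flat_exp_def)
  have gz: "t \<le> 0 \<or> t \<ge> 1 \<Longrightarrow> g t = 0" for t by (auto simp: g_def flat_exp_def)
  \<comment> \<open>The base point -1 lies left of the support of \<open>g\<close>. Hence every t >=
    0 is interior to \<open>{-1..t+1}\<close>, and the fundamental theorem on that interval gives a
    two-sided derivative.\<close>
  define G where "G t = integral {-1..t} g" for t
  have G: "(G has_real_derivative g t) (at t)" for t
  proof (cases "t < 0")
    case True
    have "G x = 0" if "x < 0" for x
      unfolding G_def using that gz by (intro integral_unique has_integral_is_0) auto
    moreover have "((\<lambda>t. 0) has_real_derivative g t) (at t)" using gz[of t] True by simp
    ultimately show ?thesis
      by (rule_tac DERIV_cong_ev[THEN iffD1, rotated -1, OF _ refl _ refl])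
         (use True in \<open>auto simp: eventually_nhds intro!: exI[of _ "{..<0}"]\<close>)
  next
    case False
    have "(G has_vector_derivative g t) (at t within {-1..t+1})"
      unfolding G_def by (rule integral_has_vector_derivative) (use cg False in auto)
    moreover have "at t within {-1..t+1} = at t"
      by (rule at_within_interior) (use False in auto)
    ultimately show ?thesis by (simp add: has_real_derivative_iff_has_vector_derivative)
  qed
  have G0: "G t = 0" if "t \<le> 0" for t
    unfolding G_def using that gz by (intro integral_unique has_integral_is_0) auto
  have G1: "G t = G 1" if "t \<ge> 1" for t
  proof -
    have "integral {-1..1} g + integral {1..t} g = integral {-1..t} g"
      using that ig by (intro Henstock_Kurzweil_Integration.integral_combine) auto
    moreover have "integral {1..t} g = 0" using gz by (intro integral_unique has_integral_is_0) auto
    ultimately show ?thesis by (simp add: G_def)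
  qed
  \<comment> \<open>The normalising constant is nonzero because \<open>g\<close> is strictly
    positive on [1/4, 3/4].\<close>
  have pos: "G 1 > 0"
  proof -
    have "\<exists>y. DERIV G x :> y \<and> y > 0" if "1/4 \<le> x" "x \<le> 3/4" for x
      using that by (intro exI[of _ "g x"] conjI G) (auto simp: g_def flat_exp_def)
    then have "G (1/4) < G (3/4)"
      by (intro DERIV_pos_imp_increasing[of "1/4" "3/4" G]) auto
    moreover have "G 0 \<le> G (1/4)" "G (3/4) \<le> G 1"
      using DERIV_nonneg_imp_nondecreasing[of 0 "1/4" G] DERIV_nonneg_imp_nondecreasing[of "3/4" 1 G] G g0
      by auto
    ultimately show ?thesis using G0[of 0] by fastforce
  qed
  have sG: "smooth G"
  proof -
    have "times_differentiable m G" for m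
    proof (cases m)
      case 0
      then show ?thesis using G by (auto intro!: continuous_at_imp_continuous_on DERIV_isCont)
    next
      case (Suc k)
      show ?thesis unfolding Suc
      proof (rule times_differentiable_SucI)
        show "(G has_derivative (\<lambda>h. g x * h)) (at x)" for x
          using G by (simp add: has_field_derivative_def)
        show "times_differentiable k (\<lambda>x. g x * v)" for v
          using sg unfolding smooth_def
          by (intro times_differentiable_bilinear[OF bounded_bilinear_mult]) auto
      qed
    qed
    then show ?thesis by (simp add: smooth_def)
  qed
  show thesis
  proof
    show "smooth (\<lambda>t. inverse (G 1) * G t)" by (intro smooth_mult sG) auto
    show "((\<lambda>t. inverse (G 1) * G t) has_real_derivative inverse (G 1) * g t) (at t)" for t
      by (auto intro!: derivative_eq_intros G)
    show "continuous_on UNIV (\<lambda>t. inverse (G 1) * g t)" by (intro continuous_intros cg)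
    show "inverse (G 1) * G t = 1" if "t \<ge> 1" for t
      using G1[OF that] pos by (metis left_inverse less_irrefl)
  qed (use G0 pos g0 gz in auto)
qed

section \<open>A potential with bounded oscillation\<close>

text \<open>
  The curves come to rest at the end point \<open>y\<close>, so that a segment can be appended smoothly; they
  need not be regular.
\<close>

definition reach :: "(real^'n \<Rightarrow> real) \<Rightarrow> 'n \<Rightarrow> real^'n \<Rightarrow> real \<Rightarrow> real \<Rightarrow> bool"
  where "reach u j y c l \<longleftrightarrow> (\<exists>\<sigma> T. 0 < T \<and> smooth \<sigma> \<and> (\<forall>t\<ge>T. \<sigma> t = y) \<and>
     c = integral {0..T} (\<lambda>t. u (\<sigma> t) * velocity \<sigma> t $ j) \<and>
     l = integral {0..T} (\<lambda>t. norm (velocity \<sigma> t)))"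

lemma reach_const: "reach u j y 0 0"
proof -
  have "velocity (\<lambda>t::real. y) = (\<lambda>t. 0)" by (intro velocity_eqI) auto
  then show ?thesis
    unfolding reach_def by (intro exI[of _ "\<lambda>t. y"] exI[of _ "1::real"]) auto
qed

text \<open>Because \<open>\<sigma>\<close> stays at \<open>y\<close> from time \<open>T\<close> on,
  adding a smoothly timed multiple of \<open>w\<close> traverses the segment without a corner and
  comes to rest again. The substitution \<tau> = s (t - T) removes the timing from both
  integrals.\<close>

lemma reach_append:
  assumes u: "continuous_on UNIV u" and "reach u j y c l"
  shows "reach u j (y + w) (c + w $ j * integral {0..1} (\<lambda>\<tau>. u (y + \<tau> *\<^sub>R w))) (l + norm w)"
proof -
  obtain \<sigma> T where T: "0 < T" "smooth \<sigma>" "\<And>t. t \<ge> T \<Longrightarrow> \<sigma> t = y"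
    and c: "c = integral {0..T} (\<lambda>t. u (\<sigma> t) * velocity \<sigma> t $ j)"
    and l: "l = integral {0..T} (\<lambda>t. norm (velocity \<sigma> t))"
    using assms(2) unfolding reach_def by auto
  obtain s s' :: "real \<Rightarrow> real" where s: "smooth s" "\<And>t. t \<le> 0 \<Longrightarrow> s t = 0" "\<And>t. t \<ge> 1 \<Longrightarrow> s t = 1"
    "\<And>t. (s has_real_derivative s' t) (at t)" "\<And>t. s' t \<ge> 0" "continuous_on UNIV s'"
    "\<And>t. t \<le> 0 \<or> t \<ge> 1 \<Longrightarrow> s' t = 0"
    by (rule exists_smooth_step) blast
  \<comment> \<open>The argument is written \<open>1 * t + - T\<close> to have the shape of
    \<open>smooth_affine\<close>.\<close>
  define \<gamma> where "\<gamma> t = \<sigma> t + s (1 * t + - T) *\<^sub>R w" for t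
  have "smooth \<gamma>"
    unfolding \<gamma>_def
    by (intro smooth_add T(2) smooth_scaleR smooth_real_compose[OF s(1)] smooth_affine smooth_const)
  have ds: "((\<lambda>t. s (t - T)) has_real_derivative s' (t - T)) (at t)" for t
    using DERIV_chain2[OF s(4), of "\<lambda>t. t - T" 1 t UNIV] DERIV_diff[OF DERIV_ident DERIV_const]
    by fastforce
  have v: "velocity \<gamma> = (\<lambda>t. velocity \<sigma> t + s' (t - T) *\<^sub>R w)"
    unfolding \<gamma>_def
    by (rule velocity_eqI)
       (auto intro!: derivative_eq_intros smooth_velocity(1)[OF T(2)]
          ds)
  \<comment> \<open>At t = \<open>T\<close> the curve is known to be constant only on the right, but
    the right-hand derivative already determines the velocity.\<close>
  have v\<sigma>: "velocity \<sigma> t = 0" if "t \<ge> T" for t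
  proof (rule vector_derivative_unique_within)
    show "at t within {t..t+1} \<noteq> bot" by (simp add: trivial_limit_within islimpt_Icc)
    show "(\<sigma> has_vector_derivative velocity \<sigma> t) (at t within {t..t+1})"
      using smooth_velocity(1)[OF T(2)] by (rule has_vector_derivative_at_within)
    show "(\<sigma> has_vector_derivative 0) (at t within {t..t+1})"
      by (rule has_vector_derivative_transform[OF _ _ has_vector_derivative_const[of y]])
         (use that T(3) in auto)
  qed
  have cont: "continuous_on A \<gamma>" "continuous_on A (velocity \<gamma>)" for A
    using \<open>smooth \<gamma>\<close> smooth_continuous smooth_velocity(2) continuous_on_subset by blast+
  have split: "integral {0..T+1} F = integral {0..T} F + integral {T..T+1} F"
    if "continuous_on {0..T+1} F" for F :: "real \<Rightarrow> real"
    using T(1) integrable_continuous_interval[OF that]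
    by (intro Henstock_Kurzweil_Integration.integral_combine[symmetric]) auto
  have subst: "integral {T..T+1} (\<lambda>t. s' (t - T) * f (s (t - T))) = integral {0..1} f"
    if "continuous_on {0..1} f" for f :: "real \<Rightarrow> real"
  proof -
    have mono: "s x \<le> s y" if "x \<le> y" for x y
      using DERIV_nonneg_imp_nondecreasing[of x y s] that s(4,5) by auto
    have s01: "s t \<in> {0..1}" for t
      using mono[of "min t 0" t] mono[of t "max t 1"] s(2)[of "min t 0"] s(3)[of "max t 1"] by auto
    have "((\<lambda>t. s' (t - T) *\<^sub>R f (s (t - T))) has_integral
             integral {s (T - T)..s (T + 1 - T)} f) {T..T+1}"
      using that s01
      by (intro has_integral_substitution[where c=0 and d=1])
         (auto intro!: DERIV_subset[OF ds] mono)
    then show ?thesis using s(2)[of 0] s(3)[of 1] by (auto dest: integral_unique)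
  qed
  show ?thesis unfolding reach_def
  proof (intro exI conjI allI impI)
    show "0 < T + 1" using T(1) by simp
    show "smooth \<gamma>" by fact
    show "\<gamma> t = y + w" if "T + 1 \<le> t" for t
      using that T(3) s(3) by (simp add: \<gamma>_def)
    have "integral {0..T} (\<lambda>t. u (\<gamma> t) * velocity \<gamma> t $ j) = c"
      unfolding c v using s(2,7) by (intro integral_cong) (auto simp: \<gamma>_def)
    moreover have "integral {T..T+1} (\<lambda>t. u (\<gamma> t) * velocity \<gamma> t $ j) =
        integral {T..T+1} (\<lambda>t. s' (t - T) * (w $ j * u (y + s (t - T) *\<^sub>R w)))"
      unfolding v using v\<sigma> T(3) by (intro integral_cong) (auto simp: \<gamma>_def)
    moreover have "\<dots> = integral {0..1} (\<lambda>\<tau>. w $ j * u (y + \<tau> *\<^sub>R w))"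
      by (rule subst) (auto intro!: continuous_intros continuous_on_compose2[OF u])
    moreover have "continuous_on {0..T+1} (\<lambda>t. u (\<gamma> t) * velocity \<gamma> t $ j)"
      by (intro continuous_intros continuous_on_compose2[OF u] cont) auto
    ultimately show "c + w $ j * integral {0..1} (\<lambda>\<tau>. u (y + \<tau> *\<^sub>R w)) =
        integral {0..T+1} (\<lambda>t. u (\<gamma> t) * velocity \<gamma> t $ j)"
      by (simp add: split)
    have "integral {0..T} (\<lambda>t. norm (velocity \<gamma> t)) = l"
      unfolding l v using s(7) by (intro integral_cong) auto
    moreover have "integral {T..T+1} (\<lambda>t. norm (velocity \<gamma> t)) =
        integral {T..T+1} (\<lambda>t. s' (t - T) * norm w)"
      unfolding v using v\<sigma> s(5) by (intro integral_cong) auto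
    moreover have "\<dots> = integral {0..1::real} (\<lambda>\<tau>. norm w)"
      by (rule subst) auto
    moreover have "continuous_on {0..T+1} (\<lambda>t. norm (velocity \<gamma> t))"
      by (intro continuous_intros cont)
    ultimately show "l + norm w = integral {0..T+1} (\<lambda>t. norm (velocity \<gamma> t))"
      by (simp add: split)
  qed
qed

text \<open>The arc length factor cancels the normalisation of the tangent, since the velocity of a
  regular curve is nonzero.\<close>

lemma tangent_integral_component:
  assumes "smooth_curve \<gamma> a b" and u: "continuous_on UNIV u"
  shows "tangent_integral u \<gamma> a b $ j = integral {a..b} (\<lambda>t. u (\<gamma> t) * velocity \<gamma> t $ j)"
proof -
  have \<gamma>: "smooth \<gamma>" "\<And>t. t \<in> {a..b} \<Longrightarrow> velocity \<gamma> t \<noteq> 0"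
    using assms(1) by (auto simp: smooth_curve_def)
  have cont: "continuous_on A \<gamma>" "continuous_on A (velocity \<gamma>)" for A
    using \<gamma>(1) smooth_continuous smooth_velocity(2) continuous_on_subset by blast+
  have eq: "tangent_integral u \<gamma> a b = integral {a..b} (\<lambda>t. u (\<gamma> t) *\<^sub>R velocity \<gamma> t)"
    unfolding tangent_integral_def unit_tangent_def using \<gamma>(2) by (intro integral_cong) auto
  show ?thesis unfolding eq
    by (subst integral_component_eq_cart[symmetric])
       (auto intro!: integrable_continuous_interval continuous_intros cont continuous_on_compose2[OF u])
qed

text \<open>
  Adding \<open>t v\<close> to a smooth curve \<open>\<sigma>\<close> makes it regular unless \<open>- v\<close> is a value of \<open>\<sigma>'\<close>; these values
  form a null set, as the dimension is at least two.
\<close>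

lemma reach_bound:
  fixes u :: "real^'n \<Rightarrow> real"
  assumes card: "CARD('n) \<ge> 2" and u: "continuous_on UNIV u"
    and M: "\<And>\<gamma> a b. smooth_curve \<gamma> a b \<Longrightarrow> curve_length \<gamma> a b \<ge> 1 \<Longrightarrow>
       norm (tangent_integral u \<gamma> a b) \<le> M * curve_length \<gamma> a b"
    and r: "reach u j y c l" and "l > 1"
  shows "\<bar>c\<bar> \<le> M * l"
proof (rule ccontr)
  assume neg: "\<not> \<bar>c\<bar> \<le> M * l"
  obtain \<sigma> T where T: "0 < T" "smooth \<sigma>"
    and c: "c = integral {0..T} (\<lambda>t. u (\<sigma> t) * velocity \<sigma> t $ j)"
    and l: "l = integral {0..T} (\<lambda>t. norm (velocity \<sigma> t))"
    using r unfolding reach_def by auto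
  have cont: "continuous_on A \<sigma>" "continuous_on A (velocity \<sigma>)" for A
    using T(2) smooth_continuous smooth_velocity(2) continuous_on_subset by blast+
  \<comment> \<open>These are the integral and the length of the perturbed curve \<sigma> t + t v.
    Both are continuous in \<open>v\<close>, and both inequalities to be kept are strict, so a
    violation at v = 0 persists on a nonempty open set, which a null set cannot cover.\<close>
  define C where "C v = integral (cbox 0 T) (\<lambda>t. u (\<sigma> t + t *\<^sub>R v) * (velocity \<sigma> t + v) $ j)" for v
  define L where "L v = integral (cbox 0 T) (\<lambda>t. norm (velocity \<sigma> t + v))" for v
  have "continuous_on UNIV C"
    unfolding C_def
    by (rule integral_continuous_on_param)
       (auto simp: case_prod_unfold
          intro!: continuous_intros continuous_on_compose2[OF u] continuous_on_compose2[OF cont(1)]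
            continuous_on_compose2[OF cont(2)])
  moreover have "continuous_on UNIV L"
    unfolding L_def
    by (rule integral_continuous_on_param)
       (auto simp: case_prod_unfold
          intro!: continuous_intros continuous_on_compose2[OF cont(2)])
  ultimately have "open {v. L v > 1}" "open {v. \<bar>C v\<bar> > M * L v}"
    by (auto intro!: open_Collect_less continuous_intros)
  then have op: "open ({v. L v > 1} \<inter> {v. \<bar>C v\<bar> > M * L v})" by (rule open_Int)
  have ne: "0 \<in> {v. L v > 1} \<inter> {v. \<bar>C v\<bar> > M * L v}"
    using neg \<open>l > 1\<close> by (auto simp: C_def L_def c l)
  have neg: "negligible ((\<lambda>t. - velocity \<sigma> t) ` {0..T})"
  proof (rule negligible_differentiable_image_lowdim)
    show "(\<lambda>t. - velocity \<sigma> t) differentiable_on {0..T}"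
      using has_derivative_minus[OF has_derivative_at_withinI[OF smooth_has_derivative[OF smooth_velocity(2)[OF T(2)]]]]
      unfolding differentiable_on_def differentiable_def by blast
  qed (use card in simp)
  have "\<not> {v. L v > 1} \<inter> {v. \<bar>C v\<bar> > M * L v} \<subseteq> (\<lambda>t. - velocity \<sigma> t) ` {0..T}"
  proof
    assume "{v. L v > 1} \<inter> {v. \<bar>C v\<bar> > M * L v} \<subseteq> (\<lambda>t. - velocity \<sigma> t) ` {0..T}"
    then have "negligible ({v. L v > 1} \<inter> {v. \<bar>C v\<bar> > M * L v})" by (rule negligible_subset[OF neg])
    then show False using open_not_negligible[OF op] ne by (metis empty_iff)
  qed
  then obtain v where v: "L v > 1" "\<bar>C v\<bar> > M * L v" "v \<notin> (\<lambda>t. - velocity \<sigma> t) ` {0..T}"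
    by auto
  define \<gamma> where "\<gamma> t = \<sigma> t + t *\<^sub>R v" for t
  have "smooth \<gamma>"
    unfolding \<gamma>_def
    by (intro smooth_add T(2) smooth_scaleR smooth_linear bounded_linear_ident smooth_const)
  have vel: "velocity \<gamma> = (\<lambda>t. velocity \<sigma> t + v)"
    unfolding \<gamma>_def
    by (rule velocity_eqI) (auto intro!: derivative_eq_intros smooth_velocity(1)[OF T(2)])
  have nz: "velocity \<gamma> t \<noteq> 0" if "t \<in> {0..T}" for t
  proof
    assume "velocity \<gamma> t = 0"
    then have "v = - velocity \<sigma> t" unfolding vel by (simp add: eq_neg_iff_add_eq_0 add.commute)
    then show False using v(3) that by blast
  qed
  have len: "curve_length \<gamma> 0 T = L v"
    by (simp add: curve_length_def L_def vel)
  have sc: "smooth_curve \<gamma> 0 T"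
    using T nz \<open>smooth \<gamma>\<close> by (auto simp: smooth_curve_def)
  have "tangent_integral u \<gamma> 0 T $ j = C v"
    unfolding tangent_integral_component[OF sc u] C_def by (simp add: vel \<gamma>_def)
  then show False
    using sc M[of \<gamma> 0 T] v len component_le_norm_cart[of "tangent_integral u \<gamma> 0 T" j] by force
qed

text \<open>Prolonging a competitor at \<open>y\<close> by a segment gives a competitor at
  \<open>y + w\<close>, which bounds \<open>p (y + w)\<close> from above; the same bound along the
  reversed segment is the bound from below. For \<open>w\<close> orthogonal to the
  \<open>j\<close>-th axis the estimate says that \<open>p\<close> varies at rate at most
  \<open>M\<close>.\<close>

lemma exists_potential:
  fixes u :: "real^'n \<Rightarrow> real"
  assumes card: "CARD('n) \<ge> 2" and u: "continuous_on UNIV u"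
    and M: "\<And>\<gamma> a b. smooth_curve \<gamma> a b \<Longrightarrow> curve_length \<gamma> a b \<ge> 1 \<Longrightarrow>
       norm (tangent_integral u \<gamma> a b) \<le> M * curve_length \<gamma> a b"
  obtains p :: "real^'n \<Rightarrow> real" where "\<And>y. \<bar>p y\<bar> \<le> 4 * M"
    and "\<And>y w. \<bar>p (y + w) - p y - w $ j * integral {0..1} (\<lambda>\<tau>. u (y + \<tau> *\<^sub>R w))\<bar> \<le> M * norm w"
proof -
  define E where "E y = {c + M * l | c l. reach u j y c l}" for y
  have lower: "x \<ge> - 4 * M" if "x \<in> E y" for x y
  proof -
    obtain c l where x: "x = c + M * l" and r: "reach u j y c l"
      using \<open>x \<in> E y\<close> by (auto simp: E_def)
    have "l \<ge> 0"
      using r smooth_continuous[OF smooth_velocity(2)] unfolding reach_def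
      by (auto intro!: Henstock_Kurzweil_Integration.integral_nonneg integrable_continuous_interval
          continuous_on_norm intro: continuous_on_subset)
    \<comment> \<open>A segment of length 2 makes every prolonged curve longer than 1, as
      \<open>reach_bound\<close> demands. Its own contribution \<open>e\<close> is at most 2 M, by
      prolonging the constant curve, so c + M l >= - M (l + 2) - 2 M + M l = - 4 M.\<close>
    have n2: "norm (axis j 2 :: real^'n) = 2" by (simp add: norm_eq_sqrt_inner inner_axis_axis)
    define e where "e = (axis j 2 :: real^'n) $ j * integral {0..1} (\<lambda>\<tau>. u (y + \<tau> *\<^sub>R axis j 2))"
    have "\<bar>c + e\<bar> \<le> M * (l + 2)"
      using reach_append[OF u r, of "axis j 2"] \<open>l \<ge> 0\<close>
      by (intro reach_bound[OF card u M, where j = j and y = "y + axis j 2"]) (auto simp: e_def n2)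
    moreover have "\<bar>0 + e\<bar> \<le> M * (0 + 2)"
      using reach_append[OF u reach_const, of j y "axis j 2"]
      by (intro reach_bound[OF card u M, where j = j and y = "y + axis j 2"]) (auto simp: e_def n2)
    ultimately show ?thesis unfolding x by (simp add: algebra_simps abs_le_iff)
  qed
  then have bdd: "bdd_below (E y)" for y by (auto simp: bdd_below_def)
  define p where "p y = Inf (E y)" for y
  have zero: "0 \<in> E y" for y using reach_const by (force simp: E_def)
  have p: "- 4 * M \<le> p y" "p y \<le> 0" for y
    unfolding p_def using lower zero[of y] by (auto intro!: cInf_greatest cInf_lower bdd)
  have step: "p (y + w) \<le> p y + w $ j * integral {0..1} (\<lambda>\<tau>. u (y + \<tau> *\<^sub>R w)) + M * norm w" for y w
  proof -
    have "p (y + w) - w $ j * integral {0..1} (\<lambda>\<tau>. u (y + \<tau> *\<^sub>R w)) - M * norm w \<le> p y"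
      unfolding p_def[of y]
    proof (rule cInf_greatest)
      show "E y \<noteq> {}" using zero by auto
      fix x assume "x \<in> E y"
      then obtain c l where x: "x = c + M * l" and r: "reach u j y c l" by (auto simp: E_def)
      have "c + w $ j * integral {0..1} (\<lambda>\<tau>. u (y + \<tau> *\<^sub>R w)) + M * (l + norm w) \<in> E (y + w)"
        using reach_append[OF u r] unfolding E_def by blast
      then show "p (y + w) - w $ j * integral {0..1} (\<lambda>\<tau>. u (y + \<tau> *\<^sub>R w)) - M * norm w \<le> x"
        unfolding p_def using cInf_lower[OF _ bdd] by (fastforce simp: x algebra_simps)
    qed
    then show ?thesis by simp
  qed
  \<comment> \<open>The average of \<open>u\<close> over a segment does not depend on its
    orientation: \<tau> is replaced by 1 - \<tau>, as a reflection followed by a shift.\<close>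
  have reflect: "integral {0..1} (\<lambda>\<tau>. u (y + w + \<tau> *\<^sub>R (- w))) = integral {0..1} (\<lambda>\<tau>. u (y + \<tau> *\<^sub>R w))"
    for y w
  proof -
    have "(\<lambda>\<tau>. u (y + w + \<tau> *\<^sub>R (- w))) = (\<lambda>\<tau>. u (y + (- (\<tau> + - 1)) *\<^sub>R w))"
      by (auto simp: algebra_simps)
    then show ?thesis
      using integral_shift_real_ivl[of "-1" "-1" 0 "\<lambda>\<tau>. u (y + (- \<tau>) *\<^sub>R w)"]
        Henstock_Kurzweil_Integration.integral_reflect_real[of 1 0 "\<lambda>\<tau>. u (y + \<tau> *\<^sub>R w)"] by simp
  qed
  show thesis
  proof
    show "\<bar>p y\<bar> \<le> 4 * M" for y using p[of y] by linarith
    show "\<bar>p (y + w) - p y - w $ j * integral {0..1} (\<lambda>\<tau>. u (y + \<tau> *\<^sub>R w))\<bar> \<le> M * norm w" for y w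
      using step[of y w] step[of "y + w" "- w"] unfolding reflect by simp
  qed
qed

section \<open>Integration against test functions\<close>

lemma integrable_continuous_compact_support:
  fixes f :: "real^'n \<Rightarrow> real"
  assumes "continuous_on UNIV f" "compact K" "\<And>x. x \<notin> K \<Longrightarrow> f x = 0"
  shows "integrable lborel f"
proof -
  have "integrable lborel (\<lambda>x. indicator K x *\<^sub>R f x)"
    using assms by (intro borel_integrable_compact) (auto intro: continuous_on_subset)
  also have "(\<lambda>x. indicator K x *\<^sub>R f x) = f"
    using assms(3) by (auto simp: indicator_def fun_eq_iff)
  finally show ?thesis .
qed

lemma lborel_integral_shift:
  fixes f :: "real^'n \<Rightarrow> real"
  assumes "continuous_on UNIV f"
  shows "(\<integral>x. f (x + c) \<partial>lborel) = (\<integral>x. f x \<partial>lborel)"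
proof -
  have "(\<integral>x. f x \<partial>lborel) = (\<integral>x. f x \<partial>distr lborel borel ((+) c))"
    by (simp add: lborel_distr_plus)
  also have "\<dots> = (\<integral>x. f (c + x) \<partial>lborel)"
    using borel_measurable_continuous_onI[OF assms] by (intro integral_distr) auto
  finally show ?thesis by (simp add: add.commute)
qed

lemma test_functionD:
  assumes "\<phi> \<in> test_functions"
  shows "smooth \<phi>" "continuous_on UNIV \<phi>" "compact (supp \<phi>)" "\<And>x. x \<notin> supp \<phi> \<Longrightarrow> \<phi> x = 0"
  using assms closure_subset[of "{x. \<phi> x \<noteq> 0}"] smooth_continuous[of \<phi>]
  by (auto simp: test_functions_def supp_def)

lemma partial_deriv_test_function:
  assumes "\<phi> \<in> test_functions"
  shows "continuous_on UNIV (partial_deriv i \<phi>)" "\<And>x. x \<notin> supp \<phi> \<Longrightarrow> partial_deriv i \<phi> x = 0"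
    "((\<lambda>t. \<phi> (x + t *\<^sub>R axis i 1)) has_real_derivative partial_deriv i \<phi> (x + t *\<^sub>R axis i 1)) (at t)"
proof -
  note \<phi> = test_functionD[OF assms]
  show "continuous_on UNIV (partial_deriv i \<phi>)"
    unfolding partial_deriv_def by (intro smooth_continuous smooth_frechet_derivative \<phi>)
  show "partial_deriv i \<phi> x = 0" if "x \<notin> supp \<phi>" for x
  proof -
    have op: "open (- supp \<phi>)" by (auto simp: supp_def)
    have "(\<phi> has_derivative (\<lambda>v. 0)) (at x)"
      by (rule has_derivative_transform_within_open[OF has_derivative_const[of 0] op])
        (use that \<phi>(4) in auto)
    then show ?thesis unfolding partial_deriv_def by (metis frechet_derivative_at)
  qed
  show "((\<lambda>t. \<phi> (x + t *\<^sub>R axis i 1)) has_real_derivative partial_deriv i \<phi> (x + t *\<^sub>R axis i 1)) (at t)"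
  proof -
    note d = smooth_has_derivative[OF \<phi>(1), of "x + t *\<^sub>R axis i 1"]
    interpret bounded_linear "frechet_derivative \<phi> (at (x + t *\<^sub>R axis i 1))"
      using d by (rule has_derivative_bounded_linear)
    have "((\<lambda>t. x + t *\<^sub>R axis i 1) has_derivative (\<lambda>h. h *\<^sub>R axis i 1)) (at t)"
      by (auto intro!: derivative_eq_intros)
    from has_derivative_compose[OF this d] show ?thesis
      unfolding has_field_derivative_def partial_deriv_def
      by (rule has_derivative_eq_rhs) (auto simp: scaleR)
  qed
qed

text \<open>Provides one compact set that contains all translates of a support by at most one step
  along \<open>e\<close>.\<close>

lemma compact_thicken:
  assumes "compact (K :: (real^'n) set)"
  shows "compact {x + t *\<^sub>R e | x t. x \<in> K \<and> t \<in> {0..1::real}}"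
proof -
  have "compact ((\<lambda>z. fst z + snd z *\<^sub>R e) ` (K \<times> {0..1::real}))"
    using assms by (intro compact_continuous_image compact_Times continuous_intros compact_Icc)
  also have "(\<lambda>z. fst z + snd z *\<^sub>R e) ` (K \<times> {0..1::real}) = {x + t *\<^sub>R e | x t. x \<in> K \<and> t \<in> {0..1}}"
    by force
  finally show ?thesis .
qed

text \<open>Since \<open>p\<close> is only continuous, the quotient is formed on the test function.
  Dominated convergence applies: the mean value theorem bounds all quotients by the maximum of the
  partial derivative, and \<open>h k <= 1\<close> confines their supports to a fixed compact
  set.\<close>

lemma difference_quotient_integral_tendsto:
  fixes p :: "real^'n \<Rightarrow> real"
  assumes p: "continuous_on UNIV p" and \<phi>: "\<phi> \<in> test_functions"
    and h: "h \<longlonglongrightarrow> 0" "\<And>k. 0 < h k" "\<And>k. h k \<le> 1"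
  shows "(\<lambda>k. \<integral>x. p x * ((\<phi> x - \<phi> (x - h k *\<^sub>R axis i 1)) / h k) \<partial>lborel)
    \<longlonglongrightarrow> (\<integral>x. p x * partial_deriv i \<phi> x \<partial>lborel)"
proof -
  note t = test_functionD[OF \<phi>] and d = partial_deriv_test_function[OF \<phi>, where i = i]
  let ?e = "axis i 1 :: real^'n"
  define K where "K = {x + t *\<^sub>R ?e | x t. x \<in> supp \<phi> \<and> t \<in> {0..1::real}}"
  have K: "compact K" unfolding K_def by (intro compact_thicken t)
  have "bounded (partial_deriv i \<phi> ` supp \<phi>)"
    using d(1) t(3) continuous_on_subset by (blast intro: compact_imp_bounded compact_continuous_image)
  then obtain B where B: "\<And>x. x \<in> supp \<phi> \<Longrightarrow> \<bar>partial_deriv i \<phi> x\<bar> \<le> B"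
    by (auto simp: bounded_iff)
  have "bounded (p ` K)"
    using p K continuous_on_subset by (blast intro: compact_imp_bounded compact_continuous_image)
  then obtain A where A: "\<And>x. x \<in> K \<Longrightarrow> \<bar>p x\<bar> \<le> A"
    by (auto simp: bounded_iff)
  have zero: "\<phi> (x - s *\<^sub>R ?e) = 0" if "x \<notin> K" "s \<in> {0..1}" for x s
  proof (rule ccontr)
    assume "\<phi> (x - s *\<^sub>R ?e) \<noteq> 0"
    then have "x - s *\<^sub>R ?e \<in> supp \<phi>" using t(4) by blast
    moreover have "x = (x - s *\<^sub>R ?e) + s *\<^sub>R ?e" by simp
    ultimately show False using that unfolding K_def by blast
  qed
  have mvt: "\<exists>z. \<phi> x - \<phi> (x - s *\<^sub>R ?e) = s * partial_deriv i \<phi> z" if s: "s > 0" for x s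
  proof -
    obtain z where "\<phi> (x + 0 *\<^sub>R ?e) - \<phi> (x + (- s) *\<^sub>R ?e) = (0 - - s) * partial_deriv i \<phi> (x + z *\<^sub>R ?e)"
      using MVT2[of "- s" 0 "\<lambda>t. \<phi> (x + t *\<^sub>R ?e)", OF _ d(3)] s by fastforce
    then show ?thesis by (intro exI[of _ "x + z *\<^sub>R ?e"]) simp
  qed
  have cont: "continuous_on UNIV (\<lambda>x. p x * ((\<phi> x - \<phi> (x - h k *\<^sub>R ?e)) / h k))" for k
    using h(2)[of k] by (intro continuous_intros p t continuous_on_compose2[OF t(2)]) auto
  show ?thesis
  proof (rule integral_dominated_convergence[where w = "\<lambda>x. indicator K x *\<^sub>R (\<bar>A\<bar> * \<bar>B\<bar>)"])
    show "(\<lambda>x. p x * partial_deriv i \<phi> x) \<in> borel_measurable lborel"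
      using borel_measurable_continuous_onI[OF continuous_on_mult[OF p d(1)]] by simp
    show "(\<lambda>x. p x * ((\<phi> x - \<phi> (x - h k *\<^sub>R ?e)) / h k)) \<in> borel_measurable lborel" for k
      using borel_measurable_continuous_onI[OF cont] by simp
    show "integrable lborel (\<lambda>x. indicator K x *\<^sub>R (\<bar>A\<bar> * \<bar>B\<bar>))"
      by (rule borel_integrable_compact[OF K]) auto
    show "AE x in lborel. (\<lambda>k. p x * ((\<phi> x - \<phi> (x - h k *\<^sub>R ?e)) / h k)) \<longlonglongrightarrow> p x * partial_deriv i \<phi> x"
    proof (intro AE_I2 tendsto_mult tendsto_const)
      fix x
      \<comment> \<open>The backward quotient at \<open>x\<close> is the usual one with increment
        \<open>- h k\<close>, and this increment never vanishes.\<close>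
      have "filterlim (\<lambda>k. - h k) (at 0) sequentially"
        using tendsto_minus[OF h(1)] h(2) by (auto simp: filterlim_at less_imp_neq intro!: always_eventually)
          (metis less_irrefl)+
      then have "(\<lambda>k. (\<phi> (x + (0 + - h k) *\<^sub>R ?e) - \<phi> (x + 0 *\<^sub>R ?e)) / - h k) \<longlonglongrightarrow> partial_deriv i \<phi> (x + 0 *\<^sub>R ?e)"
        using d(3)[of x 0] unfolding DERIV_def by (rule filterlim_compose[rotated])
      then show "(\<lambda>k. (\<phi> x - \<phi> (x - h k *\<^sub>R ?e)) / h k) \<longlonglongrightarrow> partial_deriv i \<phi> x"
        by (simp add: minus_divide_left)
    qed
    show "AE x in lborel. norm (p x * ((\<phi> x - \<phi> (x - h k *\<^sub>R ?e)) / h k)) \<le> indicator K x *\<^sub>R (\<bar>A\<bar> * \<bar>B\<bar>)" for k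
    proof (intro AE_I2)
      fix x
      show "norm (p x * ((\<phi> x - \<phi> (x - h k *\<^sub>R ?e)) / h k)) \<le> indicator K x *\<^sub>R (\<bar>A\<bar> * \<bar>B\<bar>)"
      proof (cases "x \<in> K")
        case True
        obtain z where "\<phi> x - \<phi> (x - h k *\<^sub>R ?e) = h k * partial_deriv i \<phi> z"
          using mvt h(2) by blast
        then have "norm (p x * ((\<phi> x - \<phi> (x - h k *\<^sub>R ?e)) / h k)) = \<bar>p x\<bar> * \<bar>partial_deriv i \<phi> z\<bar>"
          using h(2)[of k] by (simp add: abs_mult)
        also have "\<dots> \<le> \<bar>A\<bar> * \<bar>B\<bar>"
          using A[OF True] B[of z] d(2)[of z] by (intro mult_mono; cases "z \<in> supp \<phi>") auto
        finally show ?thesis using True by simp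
      next
        case False
        then show ?thesis
          using zero[of x 0] zero[of x "h k"] h(2,3)[of k] by simp
      qed
    qed
  qed
qed

text \<open>A weak form of "the \<open>i\<close>-th derivative of \<open>p\<close> differs from
  \<open>q\<close> by at most \<open>M\<close>", obtained without differentiating \<open>p\<close>:
  the limit of the difference quotients is taken first, then that of the error \<epsilon> in
  replacing averages of \<open>q\<close> by values.\<close>

lemma potential_integral_bound:
  fixes p q :: "real^'n \<Rightarrow> real"
  assumes p: "continuous_on UNIV p" and q: "continuous_on UNIV q" and \<phi>: "\<phi> \<in> test_functions"
    and pq: "\<And>y h. h > 0 \<Longrightarrow>
      \<bar>p (y + h *\<^sub>R axis i 1) - p y - h * integral {0..1} (\<lambda>\<tau>. q (y + \<tau> *\<^sub>R (h *\<^sub>R axis i 1)))\<bar> \<le> M * h"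
  shows "\<bar>(\<integral>x. p x * partial_deriv i \<phi> x \<partial>lborel) + (\<integral>x. q x * \<phi> x \<partial>lborel)\<bar> \<le> M * (\<integral>x. \<bar>\<phi> x\<bar> \<partial>lborel)"
proof -
  note t = test_functionD[OF \<phi>]
  let ?e = "axis i 1 :: real^'n"
  define h :: "nat \<Rightarrow> real" where "h k = inverse (real (Suc k))" for k
  have h: "h \<longlonglongrightarrow> 0" "\<And>k. 0 < h k" "\<And>k. h k \<le> 1"
    using LIMSEQ_inverse_real_of_nat unfolding h_def by (simp_all add: field_simps del: of_nat_Suc)
  define Q where "Q k = (\<integral>x. p x * ((\<phi> x - \<phi> (x - h k *\<^sub>R ?e)) / h k) \<partial>lborel)" for k
  have Qlim: "Q \<longlonglongrightarrow> (\<integral>x. p x * partial_deriv i \<phi> x \<partial>lborel)"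
    unfolding Q_def by (rule difference_quotient_integral_tendsto[OF p \<phi> h])
  have int: "integrable lborel (\<lambda>x. f x * \<phi> x)" if "continuous_on UNIV f" for f
    by (rule integrable_continuous_compact_support[OF _ t(3)])
       (auto intro!: continuous_intros that t simp: t(4))
  have int': "integrable lborel (\<lambda>x. f x * \<bar>\<phi> x\<bar>)" if "continuous_on UNIV f" for f
    by (rule integrable_continuous_compact_support[OF _ t(3)])
       (auto intro!: continuous_intros that t simp: t(4))
  have pshift: "continuous_on UNIV (\<lambda>x. p (x + c))" for c
    by (intro continuous_on_compose2[OF p]) (auto intro!: continuous_intros)
  \<comment> \<open>Discrete integration by parts: a translation by \<open>h k\<close> along the
    axis moves the difference from \<open>\<phi>\<close> to \<open>p\<close>, with a change of
    sign.\<close>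
  have Q: "Q k = (\<integral>x. (p x - p (x + h k *\<^sub>R ?e)) / h k * \<phi> x \<partial>lborel)" for k
  proof -
    let ?g = "\<lambda>x. p x * \<phi> (x - h k *\<^sub>R ?e)"
    have cg: "continuous_on UNIV ?g"
      by (intro continuous_intros p continuous_on_compose2[OF t(2)]) auto
    have "integrable lborel ?g"
    proof (rule integrable_continuous_compact_support[OF cg])
      show "compact ((\<lambda>x. x + h k *\<^sub>R ?e) ` supp \<phi>)"
        using t(3) by (intro compact_continuous_image continuous_intros)
      show "?g x = 0" if "x \<notin> (\<lambda>x. x + h k *\<^sub>R ?e) ` supp \<phi>" for x
        using that t(4)[of "x - h k *\<^sub>R ?e"] by (force simp: image_iff)
    qed
    then have "Q k = ((\<integral>x. p x * \<phi> x \<partial>lborel) - (\<integral>x. ?g x \<partial>lborel)) / h k"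
      unfolding Q_def times_divide_eq_right right_diff_distrib using int[OF p] by simp
    also have "(\<integral>x. ?g x \<partial>lborel) = (\<integral>x. p (x + h k *\<^sub>R ?e) * \<phi> x \<partial>lborel)"
      using lborel_integral_shift[OF cg, of "h k *\<^sub>R ?e"] by simp
    also have "((\<integral>x. p x * \<phi> x \<partial>lborel) - (\<integral>x. p (x + h k *\<^sub>R ?e) * \<phi> x \<partial>lborel)) / h k =
        (\<integral>x. (p x - p (x + h k *\<^sub>R ?e)) / h k * \<phi> x \<partial>lborel)"
      using int[OF p] int[OF pshift] by (simp add: left_diff_distrib diff_divide_distrib)
    finally show ?thesis .
  qed
  define I where "I = (\<integral>x. \<bar>\<phi> x\<bar> \<partial>lborel)"
  have "I \<ge> 0" by (simp add: I_def)
  have key: "\<bar>(\<integral>x. p x * partial_deriv i \<phi> x \<partial>lborel) + (\<integral>x. q x * \<phi> x \<partial>lborel)\<bar> \<le> (M + \<epsilon>) * I"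
    if "\<epsilon> > 0" for \<epsilon>
  proof -
    define K where "K = {x + t *\<^sub>R ?e | x t. x \<in> supp \<phi> \<and> t \<in> {0..1::real}}"
    have K: "compact K" unfolding K_def by (intro compact_thicken t)
    have "uniformly_continuous_on K q"
      using q K continuous_on_subset by (blast intro: compact_uniformly_continuous)
    then obtain d where d: "d > 0" "\<And>x y. x \<in> K \<Longrightarrow> y \<in> K \<Longrightarrow> dist y x < d \<Longrightarrow> dist (q y) (q x) < \<epsilon>"
      using \<open>\<epsilon> > 0\<close> unfolding uniformly_continuous_on_def by blast
    have "\<forall>\<^sub>F k in sequentially. h k < d"
      using h(1) d(1) by (rule order_tendstoD)
    then have "\<forall>\<^sub>F k in sequentially. \<bar>Q k + (\<integral>x. q x * \<phi> x \<partial>lborel)\<bar> \<le> (M + \<epsilon>) * I"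
    proof eventually_elim
      fix k assume "h k < d"
      \<comment> \<open>The hypothesis turns the quotient of \<open>p\<close> into an average of
        \<open>q\<close> up to \<open>M\<close>, and uniform continuity turns that average into
        \<open>q x\<close> up to \<epsilon>.\<close>
      have pt: "\<bar>(p x - p (x + h k *\<^sub>R ?e)) / h k + q x\<bar> \<le> M + \<epsilon>" if x: "x \<in> supp \<phi>" for x
      proof -
        let ?J = "integral {0..1} (\<lambda>\<tau>. q (x + \<tau> *\<^sub>R (h k *\<^sub>R ?e)))"
        have cq: "continuous_on {0..1} (\<lambda>\<tau>::real. q (x + \<tau> *\<^sub>R (h k *\<^sub>R ?e)))"
          by (intro continuous_on_compose2[OF q] continuous_intros) auto
        have "dist (q (x + \<tau> *\<^sub>R (h k *\<^sub>R ?e))) (q x) < \<epsilon>" if "\<tau> \<in> {0..1}" for \<tau>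
        proof (rule d(2))
          have \<tau>: "\<tau> * h k \<in> {0..1}" "\<tau> * h k \<le> h k"
            using that h(2,3)[of k] by (auto simp: mult_le_one mult_left_le_one_le)
          show "x \<in> K" using x unfolding K_def by (auto intro!: exI[of _ x] exI[of _ "0::real"])
          show "x + \<tau> *\<^sub>R h k *\<^sub>R ?e \<in> K" using x \<tau>(1) unfolding K_def by auto
          show "dist (x + \<tau> *\<^sub>R h k *\<^sub>R ?e) x < d"
            using \<tau> \<open>h k < d\<close> by (simp add: dist_norm norm_axis_1)
        qed
        then have "norm (integral {0..1} (\<lambda>\<tau>. q (x + \<tau> *\<^sub>R (h k *\<^sub>R ?e)) - q x)) \<le> \<epsilon> * (1 - 0)"
          using cq by (intro integral_bound) (auto simp: dist_norm intro!: continuous_intros less_imp_le)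
        also have "integral {0..1} (\<lambda>\<tau>. q (x + \<tau> *\<^sub>R (h k *\<^sub>R ?e)) - q x) = ?J - q x"
          using cq by (subst Henstock_Kurzweil_Integration.integral_diff) (auto intro!: integrable_continuous_interval)
        finally have J: "\<bar>?J - q x\<bar> \<le> \<epsilon>" by simp
        have "\<bar>(p (x + h k *\<^sub>R ?e) - p x - h k * ?J) / h k\<bar> \<le> M"
          using pq[OF h(2), of x k] h(2)[of k] by (simp add: abs_divide pos_divide_le_eq)
        also have "(p (x + h k *\<^sub>R ?e) - p x - h k * ?J) / h k = (p (x + h k *\<^sub>R ?e) - p x) / h k - ?J"
          using h(2)[of k] by (simp add: diff_divide_distrib)
        finally show ?thesis using J by (simp add: diff_divide_distrib)
      qed
      have c: "continuous_on UNIV (\<lambda>x. (p x - p (x + h k *\<^sub>R ?e)) / h k)"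
        using h(2)[of k] by (intro continuous_intros p pshift) auto
      have "Q k + (\<integral>x. q x * \<phi> x \<partial>lborel) = (\<integral>x. ((p x - p (x + h k *\<^sub>R ?e)) / h k + q x) * \<phi> x \<partial>lborel)"
        unfolding Q using int[OF c] int[OF q] by (simp add: distrib_right)
      also have "\<bar>\<dots>\<bar> \<le> (\<integral>x. (M + \<epsilon>) * \<bar>\<phi> x\<bar> \<partial>lborel)"
        unfolding real_norm_def[symmetric]
      proof (rule Bochner_Integration.integral_norm_bound_integral)
        show "integrable lborel (\<lambda>x. ((p x - p (x + h k *\<^sub>R ?e)) / h k + q x) * \<phi> x)"
          by (intro int continuous_intros c q)
        show "integrable lborel (\<lambda>x. (M + \<epsilon>) * norm (\<phi> x))" using int'[of "\<lambda>x. M + \<epsilon>"] by simp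
        show "norm (((p x - p (x + h k *\<^sub>R ?e)) / h k + q x) * \<phi> x) \<le> (M + \<epsilon>) * norm (\<phi> x)" for x
          using pt[of x] t(4)[of x] by (cases "x \<in> supp \<phi>") (auto simp: abs_mult intro!: mult_right_mono)
      qed
      finally show "\<bar>Q k + (\<integral>x. q x * \<phi> x \<partial>lborel)\<bar> \<le> (M + \<epsilon>) * I" by (simp add: I_def)
    qed
    then show ?thesis
      by (rule tendsto_upperbound[rotated]) (auto intro!: tendsto_intros Qlim)
  qed
  have "((\<lambda>\<epsilon>. (M + \<epsilon>) * I) \<longlongrightarrow> (M + 0) * I) (at_right 0)"
    by (intro tendsto_intros)
  moreover have "\<forall>\<^sub>F \<epsilon> in at_right 0. \<bar>(\<integral>x. p x * partial_deriv i \<phi> x \<partial>lborel) + (\<integral>x. q x * \<phi> x \<partial>lborel)\<bar> \<le> (M + \<epsilon>) * I"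
    using key by (auto simp: eventually_at_right_field intro!: exI[of _ 1])
  ultimately show ?thesis
    unfolding I_def by (intro tendsto_lowerbound[of _ _ "at_right 0"]) auto
qed

section \<open>Mollified currents of curves\<close>

lemma exists_mollifier:
  assumes "\<epsilon> > 0"
  obtains \<rho> :: "real^'n \<Rightarrow> real" where "smooth \<rho>" "\<And>x. \<rho> x \<ge> 0" "\<And>x. norm x \<ge> \<epsilon> \<Longrightarrow> \<rho> x = 0"
    "(\<integral>x. \<rho> x \<partial>lborel) = 1"
proof -
  \<comment> \<open>The squared norm is used because it is smooth at 0, unlike the norm.\<close>
  define f where "f x = flat_exp 0 (-1 * (x \<bullet> x) + \<epsilon>\<^sup>2)" for x :: "real^'n"
  have "smooth (\<lambda>x::real^'n. -1 * (x \<bullet> x) + \<epsilon>\<^sup>2)"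
    by (intro smooth_add smooth_mult smooth_inner_self smooth_const)
  then have sf: "smooth f"
    unfolding f_def by (rule smooth_real_compose[OF smooth_flat_exp])
  have norm_less: "-1 * (x \<bullet> x) + \<epsilon>\<^sup>2 > 0 \<longleftrightarrow> norm x < \<epsilon>" for x :: "real^'n"
    using assms by (simp add: power2_norm_eq_inner[symmetric] abs_less_iff flip: abs_square_less_1)
      (metis abs_norm_cancel abs_of_pos power2_less_imp_less less_imp_le norm_ge_zero power_strict_mono zero_less_numeral)
  have nn: "f x \<ge> 0" for x by (simp add: f_def flat_exp_def)
  have out: "f x = 0" if "norm x \<ge> \<epsilon>" for x
    using norm_less[of x] that by (auto simp: f_def flat_exp_def)
  have pos: "f x > 0" if "norm x < \<epsilon>" for x
    using norm_less[of x] that by (auto simp: f_def flat_exp_def)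
  have int: "integrable lborel f"
    by (rule integrable_continuous_compact_support[OF smooth_continuous[OF sf] compact_cball[of 0 \<epsilon>]])
       (auto intro!: out)
  define c where "c = (\<integral>x. f x \<partial>lborel)"
  \<comment> \<open>A vanishing integral would make the ball, where \<open>f\<close> is positive, a
    null set.\<close>
  have "c \<noteq> 0"
  proof
    assume "c = 0"
    then have "AE x in lborel. f x = 0"
      using integral_nonneg_eq_0_iff_AE[OF int] nn by (auto simp: c_def)
    then have "AE x in lborel. x \<notin> ball (0 :: real^'n) \<epsilon>"
      by eventually_elim (use pos in force)
    then have "ball (0 :: real^'n) \<epsilon> \<in> null_sets lborel"
      by (subst (asm) AE_iff_null_sets[symmetric]) auto
    then have "negligible (ball (0 :: real^'n) \<epsilon>)"
      by (simp add: negligible_iff_null_sets null_sets_completionI)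
    then show False using assms open_not_negligible[OF open_ball] by force
  qed
  moreover have "c \<ge> 0" unfolding c_def using nn by simp
  ultimately have "c > 0" by simp
  show thesis
  proof
    show "smooth (\<lambda>x. inverse c * f x)" by (intro smooth_mult smooth_const sf)
  qed (use nn out \<open>c > 0\<close> in \<open>auto simp flip: c_def\<close>)
qed

text \<open>Differentiation under the integral sign hits only \<open>f\<close> and leaves an
  integral of the same shape with a directional derivative of \<open>f\<close>. Smoothness follows
  by induction over all smooth \<open>f\<close>.\<close>

lemma smooth_curve_convolution:
  fixes f :: "real^'n \<Rightarrow> real" and \<gamma> :: "real \<Rightarrow> real^'n"
  assumes f: "smooth f" and \<gamma>: "continuous_on UNIV \<gamma>" and g: "continuous_on UNIV g"
  shows "((\<lambda>x. integral {a..b} (\<lambda>t. f (x - \<gamma> t) * g t)) has_derivative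
      (\<lambda>v. integral {a..b} (\<lambda>t. frechet_derivative f (at (x - \<gamma> t)) v * g t))) (at x)"
    and "smooth (\<lambda>x. integral {a..b} (\<lambda>t. f (x - \<gamma> t) * g t))"
proof -
  have cont: "continuous_on A (\<lambda>(x, t). f (x - \<gamma> t) * g t)" if "smooth f" for f :: "real^'n \<Rightarrow> real" and A
    unfolding case_prod_unfold
    by (intro continuous_intros continuous_on_compose2[OF smooth_continuous[OF that]]
        continuous_on_compose2[OF \<gamma>] continuous_on_compose2[OF g]) auto
  have deriv: "((\<lambda>x. integral {a..b} (\<lambda>t. f (x - \<gamma> t) * g t)) has_derivative
      (\<lambda>v. integral {a..b} (\<lambda>t. frechet_derivative f (at (x - \<gamma> t)) v * g t))) (at x)"
    if f: "smooth f" for f :: "real^'n \<Rightarrow> real" and x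
  proof -
    \<comment> \<open>\<open>leibniz_rule\<close> wants the derivative as a continuous map into the
      bounded linear maps; in finite dimension this is checked on basis vectors.\<close>
    define D where "D x t = Blinfun (\<lambda>v. frechet_derivative f (at (x - \<gamma> t)) v * g t)" for x t
    have D: "blinfun_apply (D x t) = (\<lambda>v. frechet_derivative f (at (x - \<gamma> t)) v * g t)" for x t
      unfolding D_def
      by (rule bounded_linear_Blinfun_apply)
         (intro bounded_linear_mult_const has_derivative_bounded_linear[OF smooth_has_derivative[OF f]])
    have cD: "continuous_on A (\<lambda>(x, t). D x t)" for A
    proof (rule continuous_on_blinfun_componentwise)
      fix i :: "real^'n" assume "i \<in> Basis"
      show "continuous_on A (\<lambda>z. blinfun_apply (case z of (x, t) \<Rightarrow> D x t) i)"
        using cont[OF smooth_frechet_derivative[OF f, of i]] by (simp add: case_prod_unfold D)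
    qed
    have "((\<lambda>x. integral (cbox a b) (\<lambda>t. f (x - \<gamma> t) * g t)) has_derivative
        blinfun_apply (integral (cbox a b) (D x))) (at x within UNIV)"
    proof (rule leibniz_rule)
      show "((\<lambda>x. f (x - \<gamma> t) * g t) has_derivative blinfun_apply (D x t)) (at x within UNIV)" for x t
      proof -
        have "((\<lambda>x. x - \<gamma> t) has_derivative (\<lambda>v. v)) (at x)"
          by (auto intro!: derivative_eq_intros)
        from has_derivative_compose[OF this smooth_has_derivative[OF f]]
        show ?thesis unfolding D by (intro has_derivative_mult_left) simp
      qed
      show "(\<lambda>t. f (x - \<gamma> t) * g t) integrable_on cbox a b" for x
        by (intro integrable_continuous continuous_intros continuous_on_compose2[OF smooth_continuous[OF f]]
            continuous_on_subset[OF \<gamma>] continuous_on_subset[OF g]) auto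
    qed (auto intro: cD)
    moreover have iD: "D x integrable_on cbox a b"
      by (intro integrable_continuous continuous_on_compose2[OF cD[of UNIV], of _ "\<lambda>t. (x, t)", simplified] continuous_intros)
    have "blinfun_apply (integral (cbox a b) (D x)) =
        (\<lambda>v. integral {a..b} (\<lambda>t. frechet_derivative f (at (x - \<gamma> t)) v * g t))"
      using blinfun_apply_integral[OF iD] by (simp add: fun_eq_iff D box_real)
    ultimately show ?thesis by (simp add: box_real)
  qed
  show "((\<lambda>x. integral {a..b} (\<lambda>t. f (x - \<gamma> t) * g t)) has_derivative
      (\<lambda>v. integral {a..b} (\<lambda>t. frechet_derivative f (at (x - \<gamma> t)) v * g t))) (at x)"
    by (rule deriv[OF f])
  have "times_differentiable m (\<lambda>x. integral {a..b} (\<lambda>t. f (x - \<gamma> t) * g t))" if "smooth f"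
    for f :: "real^'n \<Rightarrow> real" and m
    using that
  proof (induction m arbitrary: f)
    case 0
    show ?case
      using has_derivative_continuous[OF deriv[OF 0]] by (auto intro!: continuous_at_imp_continuous_on)
  next
    case (Suc m)
    show ?case
      by (rule times_differentiable_SucI, rule deriv[OF Suc.prems], rule Suc.IH)
         (rule smooth_frechet_derivative[OF Suc.prems])
  qed
  then show "smooth (\<lambda>x. integral {a..b} (\<lambda>t. f (x - \<gamma> t) * g t))"
    using f by (simp add: smooth_def)
qed

text \<open>All integrands vanish outside a bounded set, so a box turns the Lebesgue integral into a
  gauge integral, and Fubini for continuous functions on boxes applies.\<close>

lemma lborel_integral_swap:
  fixes F :: "real^'n \<Rightarrow> real \<Rightarrow> real"
  assumes F: "continuous_on UNIV (\<lambda>(x, t). F x t)" and "bounded K"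
    and zero: "\<And>x t. t \<in> {a..b} \<Longrightarrow> x \<notin> K \<Longrightarrow> F x t = 0"
  shows "(\<integral>x. integral {a..b} (F x) \<partial>lborel) = integral {a..b} (\<lambda>t. \<integral>x. F x t \<partial>lborel)"
proof -
  obtain A B where AB: "K \<subseteq> cbox A B"
    using bounded_subset_cbox_symmetric[OF \<open>bounded K\<close>] by blast
  have box: "(\<integral>x. f x \<partial>lborel) = integral (cbox A B) f"
    if "continuous_on UNIV f" "\<And>x. x \<notin> K \<Longrightarrow> f x = 0" for f :: "real^'n \<Rightarrow> real"
  proof -
    have "integrable lborel f"
      using that AB by (intro integrable_continuous_compact_support[OF _ compact_cbox]) auto
    moreover have "(\<lambda>x. if x \<in> cbox A B then f x else 0) = f"
      using that(2) AB by (auto simp: fun_eq_iff)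
    ultimately show ?thesis
      using Henstock_Kurzweil_Integration.integral_restrict_UNIV[of "cbox A B" f]
      by (simp add: integral_lborel)
  qed
  have "continuous_on UNIV (\<lambda>x. integral (cbox a b) (F x))"
    using F continuous_on_subset by (intro integral_continuous_on_param) blast
  then have "(\<integral>x. integral {a..b} (F x) \<partial>lborel) = integral (cbox A B) (\<lambda>x. integral (cbox a b) (F x))"
    by (subst box) (auto intro!: integral_unique has_integral_is_0 zero)
  also have "\<dots> = integral (cbox a b) (\<lambda>t. integral (cbox A B) (\<lambda>x. F x t))"
    using F continuous_on_subset by (intro integral_swap_continuous) blast
  also have "\<dots> = integral {a..b} (\<lambda>t. \<integral>x. F x t \<partial>lborel)"
  proof (unfold box_real, rule integral_cong)
    fix t assume "t \<in> {a..b}"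
    have "continuous_on UNIV (\<lambda>x. F x t)"
      using continuous_on_compose2[OF F continuous_on_Pair[OF continuous_on_id continuous_on_const]]
      by simp
    then show "integral (cbox A B) (\<lambda>x. F x t) = (\<integral>x. F x t \<partial>lborel)"
      using zero \<open>t \<in> {a..b}\<close> by (intro box[symmetric])
  qed
  finally show ?thesis .
qed

lemma test_functionsI:
  fixes \<phi> :: "real^'n \<Rightarrow> real"
  assumes "smooth \<phi>" "compact K" "\<And>x. x \<notin> K \<Longrightarrow> \<phi> x = 0"
  shows "\<phi> \<in> test_functions"
proof -
  have "supp \<phi> \<subseteq> K"
    unfolding supp_def using assms(2,3) by (intro closure_minimal compact_imp_closed) auto
  moreover have "closed (supp \<phi>)" by (simp add: supp_def)
  ultimately have "compact (supp \<phi>)"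
    using assms(2) by (metis compact_Int_closed inf.absorb_iff2)
  then show ?thesis using assms(1) by (simp add: test_functions_def)
qed

lemma partial_deriv_sum_eq_derivative:
  fixes f :: "real^'n \<Rightarrow> real"
  assumes "smooth f"
  shows "(\<Sum>i\<in>UNIV. partial_deriv i f x * v $ i) = frechet_derivative f (at x) v"
proof -
  interpret bounded_linear "frechet_derivative f (at x)"
    by (rule has_derivative_bounded_linear[OF smooth_has_derivative[OF assms]])
  have "frechet_derivative f (at x) v = frechet_derivative f (at x) (\<Sum>i\<in>UNIV. (v $ i) *\<^sub>R axis i 1)"
    using basis_expansion[of v] by (simp add: scalar_mult_eq_scaleR)
  also have "\<dots> = (\<Sum>i\<in>UNIV. partial_deriv i f x * v $ i)"
    by (simp add: sum scaleR partial_deriv_def mult.commute)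
  finally show ?thesis by simp
qed

text \<open>
  The mollified current \<open>V i\<close> is the convolution of a mollifier with the \<open>i\<close>-th component of the
  tangential measure of \<open>\<gamma>\<close>; its divergence only sees the two end points.
\<close>

lemma exists_mollified_current:
  fixes u :: "real^'n \<Rightarrow> real"
  assumes u: "continuous_on UNIV u" and \<gamma>: "smooth_curve \<gamma> a b" and "\<eta> > 0"
  obtains V :: "'n \<Rightarrow> real^'n \<Rightarrow> real" where "\<And>i. V i \<in> test_functions"
    "\<And>i. (\<integral>x. \<bar>V i x\<bar> \<partial>lborel) \<le> curve_length \<gamma> a b"
    "(\<integral>x. \<bar>\<Sum>i\<in>UNIV. partial_deriv i (V i) x\<bar> \<partial>lborel) \<le> (if \<gamma> a = \<gamma> b then 0 else 2)"
    "\<And>i. \<bar>(\<integral>x. u x * V i x \<partial>lborel) - tangent_integral u \<gamma> a b $ i\<bar> \<le> \<eta> * curve_length \<gamma> a b"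
proof -
  have ab: "a < b" and s\<gamma>: "smooth \<gamma>" using \<gamma> by (auto simp: smooth_curve_def)
  note c\<gamma> = smooth_continuous[OF s\<gamma>] and cv = smooth_continuous[OF smooth_velocity(2)[OF s\<gamma>]]
  have "bounded (\<gamma> ` {a..b})"
    by (intro compact_imp_bounded compact_continuous_image continuous_on_subset[OF c\<gamma>]) auto
  then obtain R where R: "\<And>t. t \<in> {a..b} \<Longrightarrow> norm (\<gamma> t) \<le> R"
    unfolding bounded_iff by blast
  \<comment> \<open>The extra 1 leaves room for the support of the mollifier, whose radius
    \<open>min d 1\<close> also respects the modulus of continuity of \<open>u\<close>.\<close>
  define K where "K = cball (0 :: real^'n) (R + 1)"
  have "uniformly_continuous_on K u"
    unfolding K_def using u by (intro compact_uniformly_continuous continuous_on_subset[OF u]) auto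
  then obtain d where d: "d > 0" "\<And>x y. x \<in> K \<Longrightarrow> y \<in> K \<Longrightarrow> dist y x < d \<Longrightarrow> dist (u y) (u x) < \<eta>"
    using \<open>\<eta> > 0\<close> unfolding uniformly_continuous_on_def by blast
  obtain \<rho> :: "real^'n \<Rightarrow> real" where \<rho>: "smooth \<rho>" "\<And>x. \<rho> x \<ge> 0"
    "\<And>x. norm x \<ge> min d 1 \<Longrightarrow> \<rho> x = 0" "(\<integral>x. \<rho> x \<partial>lborel) = 1"
    using exists_mollifier[of "min d 1"] d(1) by auto
  note c\<rho> = smooth_continuous[OF \<rho>(1)]
  have zero: "\<rho> (x - \<gamma> t) = 0" if "t \<in> {a..b}" "x \<notin> K" for x t
    using R[OF that(1)] that(2) norm_triangle_ineq2[of x "\<gamma> t"] by (intro \<rho>(3)) (auto simp: K_def)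
  have ic: "(\<lambda>t. \<rho> (x - \<gamma> t) * g t) integrable_on {a..b}" if "continuous_on UNIV g" for g x
    by (intro integrable_continuous_interval continuous_intros continuous_on_compose2[OF c\<rho>]
        continuous_on_subset[OF c\<gamma>] continuous_on_subset[OF that]) auto
  have c\<rho>s: "continuous_on UNIV (\<lambda>x. \<rho> (x - c))" for c
    by (intro continuous_on_compose2[OF c\<rho>] continuous_intros) auto
  have shift: "(\<integral>x. \<rho> (x - c) \<partial>lborel) = 1" for c
    using lborel_integral_shift[OF c\<rho>, of "- c"] \<rho>(4) by simp
  define conv where "conv g x = integral {a..b} (\<lambda>t. \<rho> (x - \<gamma> t) * g t)" for g x
  have sconv: "smooth (conv g)" if "continuous_on UNIV g" for g
    unfolding conv_def by (rule smooth_curve_convolution(2)[OF \<rho>(1) c\<gamma> that])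
  have conv0: "conv g x = 0" if "x \<notin> K" for g x
    unfolding conv_def using that by (auto intro!: integral_unique has_integral_is_0 simp: zero)
  have K: "compact K" by (simp add: K_def)
  have intconv: "integrable lborel (\<lambda>x. w x * conv g x)" if "continuous_on UNIV w" "continuous_on UNIV g" for w g
    by (rule integrable_continuous_compact_support[OF _ K])
       (auto intro!: continuous_intros that smooth_continuous[OF sconv] simp: conv0)
  \<comment> \<open>Fubini: each translate of \<rho> has integral 1, so smearing preserves the total
    mass.\<close>
  have mass: "(\<integral>x. conv g x \<partial>lborel) = integral {a..b} g" if g: "continuous_on UNIV g" for g
  proof -
    have "continuous_on UNIV (\<lambda>(x, t). \<rho> (x - \<gamma> t) * g t)"
      unfolding case_prod_unfold
      by (intro continuous_intros continuous_on_compose2[OF c\<rho>]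
          continuous_on_compose2[OF c\<gamma>] continuous_on_compose2[OF g]) auto
    then have "(\<integral>x. conv g x \<partial>lborel) = integral {a..b} (\<lambda>t. \<integral>x. \<rho> (x - \<gamma> t) * g t \<partial>lborel)"
      unfolding conv_def using zero by (intro lborel_integral_swap[where K = K]) (auto simp: K_def)
    then show ?thesis by (simp add: shift)
  qed
  \<comment> \<open>The smeared speed dominates every component of the current and has the length of
    the curve as its integral.\<close>
  define S where "S t = norm (velocity \<gamma> t)" for t
  have cS: "continuous_on UNIV S" unfolding S_def by (intro continuous_intros cv)
  have massS: "(\<integral>x. conv S x \<partial>lborel) = curve_length \<gamma> a b"
    using mass[OF cS] by (simp add: curve_length_def S_def[abs_def])
  have cvi: "continuous_on UNIV (\<lambda>t. velocity \<gamma> t $ i)" for i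
    by (intro continuous_intros cv)
  have vS: "\<bar>velocity \<gamma> t $ i\<bar> \<le> S t" for t i
    unfolding S_def by (rule component_le_norm_cart)
  define V where "V i = conv (\<lambda>t. velocity \<gamma> t $ i)" for i
  show thesis
  proof
    show test: "V i \<in> test_functions" for i
      unfolding V_def using conv0 by (intro test_functionsI[OF sconv[OF cvi] K])
    show "(\<integral>x. \<bar>V i x\<bar> \<partial>lborel) \<le> curve_length \<gamma> a b" for i
      unfolding massS[symmetric]
    proof (rule integral_mono)
      show "integrable lborel (\<lambda>x. \<bar>V i x\<bar>)"
        using intconv[OF continuous_on_const cvi, of 1 i] by (auto simp: V_def)
      show "integrable lborel (conv S)"
        using intconv[OF continuous_on_const cS, of 1] by simp
      show "\<bar>V i x\<bar> \<le> conv S x" for x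
        unfolding V_def conv_def real_norm_def[symmetric] using \<rho>(2) vS
        by (intro Henstock_Kurzweil_Integration.integral_norm_bound_integral ic cS cvi)
           (auto simp: abs_mult intro!: mult_left_mono)
    qed
    \<comment> \<open>Summed over \<open>i\<close>, the integrand is the derivative of \<rho> at x -
      \<gamma> t along the velocity, which is minus the t-derivative of \<rho> (x - \<gamma> t).
      Only the end points survive.\<close>
    have "(\<Sum>i\<in>UNIV. partial_deriv i (V i) x) = \<rho> (x - \<gamma> a) - \<rho> (x - \<gamma> b)" for x
    proof -
      have pd: "partial_deriv i (V i) x =
          integral {a..b} (\<lambda>t. partial_deriv i \<rho> (x - \<gamma> t) * velocity \<gamma> t $ i)" for i
        using frechet_derivative_at[OF smooth_curve_convolution(1)[OF \<rho>(1) c\<gamma> cvi, of a b i x]]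
        unfolding V_def conv_def partial_deriv_def by (simp add: fun_eq_iff eq_commute)
      have cpd: "continuous_on UNIV (partial_deriv i \<rho>)" for i
        unfolding partial_deriv_def by (intro smooth_continuous smooth_frechet_derivative \<rho>)
      have "(\<Sum>i\<in>UNIV. partial_deriv i (V i) x) =
          integral {a..b} (\<lambda>t. \<Sum>i\<in>UNIV. partial_deriv i \<rho> (x - \<gamma> t) * velocity \<gamma> t $ i)"
        unfolding pd
        by (intro integral_sum[symmetric] integrable_continuous_interval continuous_intros
            continuous_on_compose2[OF cpd] continuous_on_subset[OF c\<gamma>] continuous_on_subset[OF cv]) auto
      also have "\<dots> = integral {a..b} (\<lambda>t. - frechet_derivative \<rho> (at (x - \<gamma> t)) (- velocity \<gamma> t))"
      proof (rule integral_cong)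
        fix t
        have "linear (frechet_derivative \<rho> (at (x - \<gamma> t)))"
          by (rule has_derivative_linear[OF smooth_has_derivative[OF \<rho>(1)]])
        then show "(\<Sum>i\<in>UNIV. partial_deriv i \<rho> (x - \<gamma> t) * velocity \<gamma> t $ i) =
            - frechet_derivative \<rho> (at (x - \<gamma> t)) (- velocity \<gamma> t)"
          by (simp add: partial_deriv_sum_eq_derivative[OF \<rho>(1)] linear_neg)
      qed
      also have "\<dots> = - (\<rho> (x - \<gamma> b)) - - (\<rho> (x - \<gamma> a))"
      proof (intro integral_unique fundamental_theorem_of_calculus)
        fix t
        have "((\<lambda>t. x - \<gamma> t) has_vector_derivative - velocity \<gamma> t) (at t)"
          by (auto intro!: derivative_eq_intros smooth_velocity(1)[OF s\<gamma>])
        from vector_derivative_diff_chain_within[OF this has_derivative_at_withinI[OF smooth_has_derivative[OF \<rho>(1)]]]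
        have "((\<lambda>t. - \<rho> (x - \<gamma> t)) has_vector_derivative
            - frechet_derivative \<rho> (at (x - \<gamma> t)) (- velocity \<gamma> t)) (at t)"
          by (intro has_vector_derivative_minus) (simp add: o_def)
        then show "((\<lambda>t. - \<rho> (x - \<gamma> t)) has_vector_derivative
            - frechet_derivative \<rho> (at (x - \<gamma> t)) (- velocity \<gamma> t)) (at t within {a..b})"
          by (rule has_vector_derivative_at_within)
      qed (use ab in simp)
      finally show ?thesis by simp
    qed
    \<comment> \<open>Equal end points cancel the bumps; otherwise each of them has mass 1.\<close>
    moreover have "(\<integral>x. \<bar>\<rho> (x - \<gamma> a) - \<rho> (x - \<gamma> b)\<bar> \<partial>lborel) \<le> (if \<gamma> a = \<gamma> b then 0 else 2)"
    proof -
      have i: "integrable lborel (\<lambda>x. \<rho> (x - \<gamma> t))" if "t \<in> {a..b}" for t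
        by (rule integrable_continuous_compact_support[OF c\<rho>s K]) (rule zero[OF that])
      have "(\<integral>x. \<bar>\<rho> (x - \<gamma> a) - \<rho> (x - \<gamma> b)\<bar> \<partial>lborel) \<le> (\<integral>x. \<rho> (x - \<gamma> a) + \<rho> (x - \<gamma> b) \<partial>lborel)"
        using i[of a] i[of b] ab \<rho>(2) by (intro integral_mono) (auto simp: abs_le_iff intro: add_increasing add_increasing2)
      also have "\<dots> = 2" using i[of a] i[of b] ab by (simp add: shift)
      finally show ?thesis by auto
    qed
    ultimately show "(\<integral>x. \<bar>\<Sum>i\<in>UNIV. partial_deriv i (V i) x\<bar> \<partial>lborel) \<le> (if \<gamma> a = \<gamma> b then 0 else 2)"
      by simp
    show "\<bar>(\<integral>x. u x * V i x \<partial>lborel) - tangent_integral u \<gamma> a b $ i\<bar> \<le> \<eta> * curve_length \<gamma> a b" for i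
    proof -
      define g where "g t = velocity \<gamma> t $ i" for t
      have cg: "continuous_on UNIV g" unfolding g_def by (rule cvi)
      have cu\<gamma>: "continuous_on UNIV (\<lambda>t. u (\<gamma> t))"
        by (intro continuous_on_compose2[OF u c\<gamma>]) auto
      have cug: "continuous_on UNIV (\<lambda>t. u (\<gamma> t) * g t)" by (intro continuous_intros cu\<gamma> cg)
      have i1: "integrable lborel (\<lambda>x. u x * conv g x)" by (rule intconv[OF u cg])
      have i2: "integrable lborel (conv (\<lambda>t. u (\<gamma> t) * g t))"
        using intconv[OF continuous_on_const cug, of 1] by simp
      \<comment> \<open>Smearing \<open>u\<close> times the velocity and multiplying the smeared
        velocity by \<open>u\<close> differ only through u x - u (\<gamma> t). This is at most
        \<eta> wherever \<rho> (x - \<gamma> t) is nonzero.\<close>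
      have pt: "norm (u x * conv g x - conv (\<lambda>t. u (\<gamma> t) * g t) x) \<le> \<eta> * conv S x" for x
      proof -
        have "u x * conv g x - conv (\<lambda>t. u (\<gamma> t) * g t) x =
            integral {a..b} (\<lambda>t. u x * (\<rho> (x - \<gamma> t) * g t) - \<rho> (x - \<gamma> t) * (u (\<gamma> t) * g t))"
          unfolding conv_def using ic[OF cg, of x] ic[OF cug, of x]
          by (subst Henstock_Kurzweil_Integration.integral_diff) (auto intro!: integrable_on_mult_right)
        also have "norm \<dots> \<le> integral {a..b} (\<lambda>t. \<eta> * (\<rho> (x - \<gamma> t) * S t))"
        proof (rule Henstock_Kurzweil_Integration.integral_norm_bound_integral)
          show "(\<lambda>t. u x * (\<rho> (x - \<gamma> t) * g t) - \<rho> (x - \<gamma> t) * (u (\<gamma> t) * g t)) integrable_on {a..b}"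
            using ic[OF cg, of x] ic[OF cug, of x]
            by (intro Henstock_Kurzweil_Integration.integrable_diff integrable_on_mult_right)
          show "(\<lambda>t. \<eta> * (\<rho> (x - \<gamma> t) * S t)) integrable_on {a..b}"
            by (intro integrable_on_mult_right ic cS)
          fix t assume t: "t \<in> {a..b}"
          have "norm (u x * (\<rho> (x - \<gamma> t) * g t) - \<rho> (x - \<gamma> t) * (u (\<gamma> t) * g t)) =
              \<bar>u x - u (\<gamma> t)\<bar> * (\<rho> (x - \<gamma> t) * \<bar>g t\<bar>)"
          proof -
            have "u x * (\<rho> (x - \<gamma> t) * g t) - \<rho> (x - \<gamma> t) * (u (\<gamma> t) * g t) =
                (u x - u (\<gamma> t)) * (\<rho> (x - \<gamma> t) * g t)" by (simp add: algebra_simps)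
            then show ?thesis using \<rho>(2)[of "x - \<gamma> t"] by (simp add: abs_mult)
          qed
          also have "\<dots> \<le> \<eta> * (\<rho> (x - \<gamma> t) * S t)"
          proof (cases "norm (x - \<gamma> t) < min d 1")
            case True
            have "\<gamma> t \<in> K" using R[OF t] by (simp add: K_def)
            moreover have "x \<in> K" using R[OF t] True norm_triangle_ineq2[of x "\<gamma> t"] by (simp add: K_def)
            ultimately have "\<bar>u x - u (\<gamma> t)\<bar> \<le> \<eta>"
              using d(2)[of "\<gamma> t" x] True by (simp add: dist_norm)
            then show ?thesis using \<rho>(2)[of "x - \<gamma> t"] vS[of t i] \<open>\<eta> > 0\<close>
              unfolding g_def by (intro mult_mono) auto
          next
            case False
            then have "\<rho> (x - \<gamma> t) = 0" by (intro \<rho>(3)) (use False in linarith)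
            then show ?thesis by simp
          qed
          finally show "norm (u x * (\<rho> (x - \<gamma> t) * g t) - \<rho> (x - \<gamma> t) * (u (\<gamma> t) * g t)) \<le> \<eta> * (\<rho> (x - \<gamma> t) * S t)" .
        qed
        finally show ?thesis by (simp add: conv_def)
      qed
      have "(\<integral>x. u x * V i x \<partial>lborel) - tangent_integral u \<gamma> a b $ i =
          (\<integral>x. u x * conv g x - conv (\<lambda>t. u (\<gamma> t) * g t) x \<partial>lborel)"
        using i1 i2 mass[OF cug] by (simp add: tangent_integral_component[OF \<gamma> u] V_def g_def[abs_def])
      also have "norm \<dots> \<le> (\<integral>x. \<eta> * conv S x \<partial>lborel)"
        using i1 i2 pt intconv[OF continuous_on_const cS, of \<eta>]
        by (intro Bochner_Integration.integral_norm_bound_integral) auto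
      finally show ?thesis by (simp add: massS)
    qed
  qed
qed

section \<open>Forms of codimension one as vector fields\<close>

lemma multi_indices_codim_one:
  "multi_indices (CARD('n) - 1) = range (\<lambda>j. UNIV - {j :: 'n::finite})"
proof -
  have "\<exists>j. I = UNIV - {j}" if "card I = CARD('n) - 1" for I :: "'n set"
  proof -
    have "card (- I) = 1"
      using that card_Diff_subset[of I UNIV] zero_less_card_finite[where 'a='n]
      by (simp add: Compl_eq_Diff_UNIV del: zero_less_card_finite)
    then obtain j where "- I = {j}" by (rule card_1_singletonE)
    then show ?thesis by (intro exI[of _ j]) auto
  qed
  then show ?thesis by (auto simp: multi_indices_def card_Diff_singleton)
qed

lemma sum_multi_indices_codim_one:
  "(\<Sum>I\<in>multi_indices (CARD('n) - 1). F I) = (\<Sum>j\<in>UNIV. F (UNIV - {j :: 'n::finite}))"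
  unfolding multi_indices_codim_one by (subst sum.reindex) (auto simp: inj_def)

lemma multi_indices_top: "multi_indices (CARD('n) - 1 + 1) = {UNIV :: 'n::finite set}"
proof -
  have "CARD('n) - 1 + 1 = CARD('n)" using zero_less_card_finite[where 'a='n] by simp
  then show ?thesis by (auto simp: multi_indices_def dest: card_eq_UNIV_imp_eq_UNIV[rotated])
qed

lemma test_functions_scale:
  assumes "\<phi> \<in> test_functions"
  shows "(\<lambda>x. c * \<phi> x) \<in> test_functions"
  using test_functionD[OF assms]
  by (intro test_functionsI[where K = "supp \<phi>"] smooth_mult smooth_const) auto

lemma partial_deriv_scale:
  assumes "\<phi> \<in> test_functions"
  shows "partial_deriv i (\<lambda>x. c * \<phi> x) = (\<lambda>x. c * partial_deriv i \<phi> x)"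
proof
  fix x
  have "((\<lambda>x. c * \<phi> x) has_derivative (\<lambda>v. c * frechet_derivative \<phi> (at x) v)) (at x)"
    by (intro has_derivative_mult_right smooth_has_derivative test_functionD[OF assms])
  then show "partial_deriv i (\<lambda>x. c * \<phi> x) x = c * partial_deriv i \<phi> x"
    unfolding partial_deriv_def by (metis frechet_derivative_at)
qed

text \<open>The norm \<open>Upsilon1_norm\<close> of a form of codimension one, read in the
  components of the corresponding vector field.\<close>

definition field_norm :: "('n \<Rightarrow> real^'n::finite \<Rightarrow> real) \<Rightarrow> real"
  where "field_norm V = (\<Sum>j\<in>UNIV. \<integral>x. \<bar>V j x\<bar> \<partial>lborel) + (\<integral>x. \<bar>\<Sum>j\<in>UNIV. partial_deriv j (V j) x\<bar> \<partial>lborel)"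

text \<open>The sign attached to the \<open>j\<close>-th component is the one with which
  \<open>ext_deriv\<close> weights its derivative, so the signs cancel and the exterior derivative
  is the plain divergence.\<close>

lemma codim_one_form:
  fixes V :: "'n \<Rightarrow> real^'n::{finite,linorder} \<Rightarrow> real"
  assumes V: "\<And>j. V j \<in> test_functions"
    and \<Phi>: "\<And>j. \<Phi> (UNIV - {j}) = (\<lambda>x. (-1) ^ card {i. i < j} * V j x)"
  shows "\<Phi> \<in> test_forms (CARD('n) - 1)" and "Upsilon1_norm (CARD('n) - 1) \<Phi> = field_norm V"
proof -
  show "\<Phi> \<in> test_forms (CARD('n) - 1)"
    using V by (auto simp: test_forms_def multi_indices_codim_one \<Phi> intro: test_functions_scale
        simp del: One_nat_def)
  have "ext_deriv \<Phi> UNIV = (\<lambda>x. \<Sum>j\<in>UNIV. partial_deriv j (V j) x)"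
    unfolding ext_deriv_def \<Phi> partial_deriv_scale[OF V]
    by (auto simp: power_mult_distrib[symmetric] simp flip: mult.assoc)
  then show "Upsilon1_norm (CARD('n) - 1) \<Phi> = field_norm V"
    by (simp add: Upsilon1_norm_def L1_norm_def sum_multi_indices_codim_one multi_indices_top \<Phi>
        abs_mult power_abs field_norm_def del: One_nat_def)
qed

lemma distribution_of_scale: "distribution_of u (\<lambda>x. c * \<phi> x) = c * distribution_of u \<phi>"
proof -
  have "(\<lambda>x. u x * (c * \<phi> x)) = (\<lambda>x. c * (u x * \<phi> x))" by (simp add: mult.left_commute)
  then show ?thesis by (simp add: distribution_of_def)
qed

text \<open>Each coefficient differs from a component of the field by a sign, which is its own
  inverse and disappears under the absolute value.\<close>

lemma d_norm_codim_one_leI: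
  fixes u :: "real^'n::{finite,linorder} \<Rightarrow> real"
  assumes "\<And>V j. (\<And>i. V i \<in> test_functions) \<Longrightarrow> field_norm V \<le> 1 \<Longrightarrow> \<bar>distribution_of u (V j)\<bar> \<le> D"
  shows "d_norm (CARD('n) - 1) (distribution_of u) \<le> ennreal D"
  unfolding d_norm_def
proof (rule SUP_least, rule ennreal_leI)
  fix \<Phi> :: "'n form"
  assume "\<Phi> \<in> {\<Phi> \<in> test_forms (CARD('n) - 1). Upsilon1_norm (CARD('n) - 1) \<Phi> \<le> 1}"
  then have \<Phi>: "\<Phi> (UNIV - {j}) \<in> test_functions" and norm: "Upsilon1_norm (CARD('n) - 1) \<Phi> \<le> 1" for j
    by (auto simp: test_forms_def multi_indices_codim_one simp del: One_nat_def)
  define V where "V j x = (-1) ^ card {i. i < j} * \<Phi> (UNIV - {j}) x" for j x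
  have V: "V j \<in> test_functions" for j
    using test_functions_scale[OF \<Phi>] by (simp add: V_def[abs_def])
  have \<Phi>V: "\<Phi> (UNIV - {j}) = (\<lambda>x. (-1) ^ card {i. i < j} * V j x)" for j
    by (simp add: V_def flip: mult.assoc power_mult_distrib)
  have "\<bar>distribution_of u (\<Phi> (UNIV - {j}))\<bar> \<le> D" for j
    using assms[of V j, OF V] codim_one_form(2)[of V \<Phi>, OF V \<Phi>V] norm
    by (simp add: \<Phi>V distribution_of_scale abs_mult power_abs)
  then show "Max ((\<lambda>I. \<bar>distribution_of u (\<Phi> I)\<bar>) ` multi_indices (CARD('n) - 1)) \<le> D"
    by (intro Max.boundedI) (auto simp: multi_indices_codim_one simp del: One_nat_def)
qed

text \<open>The supremum in \<open>d_norm\<close> in homogeneous form. Scaling by a positive bound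
  \<open>N\<close> instead of the norm itself includes fields with
  \<open>field_norm V = 0\<close>.\<close>

lemma distribution_of_le_d_norm:
  fixes u :: "real^'n::{finite,linorder} \<Rightarrow> real"
  assumes D: "d_norm (CARD('n) - 1) (distribution_of u) \<le> ennreal D" "0 \<le> D"
    and V: "\<And>i. V i \<in> test_functions" and N: "field_norm V \<le> N" "0 < N"
  shows "\<bar>distribution_of u (V j)\<bar> \<le> D * N"
proof -
  define W where "W j x = inverse N * V j x" for j x
  have W: "W j \<in> test_functions" for j
    using test_functions_scale[OF V] by (simp add: W_def[abs_def])
  have pW: "partial_deriv j (W j) = (\<lambda>x. inverse N * partial_deriv j (V j) x)" for j
    using partial_deriv_scale[OF V] by (simp add: W_def[abs_def])
  have fW: "field_norm W = inverse N * field_norm V"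
    using N(2) unfolding field_norm_def pW
    by (simp add: W_def abs_mult distrib_left flip: sum_distrib_left)
  then have W1: "field_norm W \<le> 1" unfolding fW using N by (simp add: field_simps)
  \<comment> \<open>The sum has a single term when \<open>I\<close> omits one coordinate; it
    recovers that coordinate from \<open>I\<close> without a choice operator.\<close>
  define \<Phi> where "\<Phi> I x = (\<Sum>i\<in>- I. (-1) ^ card {k. k < i} * W i x)" for I x
  have \<Phi>: "\<Phi> (UNIV - {i}) = (\<lambda>x. (-1) ^ card {k. k < i} * W i x)" for i
  proof -
    have "- (UNIV - {i}) = {i}" by auto
    then show ?thesis by (simp add: \<Phi>_def[abs_def])
  qed
  have "\<bar>distribution_of u (\<Phi> (UNIV - {j}))\<bar> \<le>
      Max ((\<lambda>I. \<bar>distribution_of u (\<Phi> I)\<bar>) ` multi_indices (CARD('n) - 1))"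
    by (intro Max_ge) (auto simp: multi_indices_codim_one simp del: One_nat_def)
  also have "\<dots> \<le> D"
  proof -
    have "ennreal (Max ((\<lambda>I. \<bar>distribution_of u (\<Phi> I)\<bar>) ` multi_indices (CARD('n) - 1)))
        \<le> d_norm (CARD('n) - 1) (distribution_of u)"
      unfolding d_norm_def using codim_one_form[of W \<Phi>, OF W \<Phi>] W1 by (intro SUP_upper) simp
    then show ?thesis using D order_trans ennreal_le_iff[OF D(2)] by blast
  qed
  finally have "\<bar>distribution_of u (\<Phi> (UNIV - {j}))\<bar> \<le> D" .
  then have "inverse N * \<bar>distribution_of u (V j)\<bar> \<le> D"
    using N(2) by (simp add: \<Phi> W_def distribution_of_scale abs_mult power_abs)
  then show ?thesis using N(2) by (simp add: field_simps)
qed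

section \<open>The two inequalities\<close>

lemma tangent_integral_le_d_norm:
  fixes u :: "real^'n::{finite,linorder} \<Rightarrow> real"
  assumes u: "continuous_on UNIV u" and D: "d_norm (CARD('n) - 1) (distribution_of u) \<le> ennreal D" "0 \<le> D"
    and \<gamma>: "smooth_curve \<gamma> a b" and len: "curve_length \<gamma> a b > 0"
  shows "norm (tangent_integral u \<gamma> a b) \<le>
    CARD('n) * (D * (CARD('n) * curve_length \<gamma> a b + (if \<gamma> a = \<gamma> b then 0 else 2)))"
proof -
  let ?l = "curve_length \<gamma> a b" and ?N = "CARD('n) * curve_length \<gamma> a b + (if \<gamma> a = \<gamma> b then 0 else 2)"
  have "\<bar>tangent_integral u \<gamma> a b $ i\<bar> \<le> D * ?N" for i
  proof (rule field_le_epsilon)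
    fix e :: real assume "e > 0"
    \<comment> \<open>With \<eta> = e / length, the mollification error \<eta> * length is exactly
      \<open>e\<close>.\<close>
    then have "e / ?l > 0" using len by simp
    then obtain V where V: "\<And>i. V i \<in> test_functions" "\<And>i. (\<integral>x. \<bar>V i x\<bar> \<partial>lborel) \<le> ?l"
      "(\<integral>x. \<bar>\<Sum>i\<in>UNIV. partial_deriv i (V i) x\<bar> \<partial>lborel) \<le> (if \<gamma> a = \<gamma> b then 0 else 2)"
      "\<And>i. \<bar>(\<integral>x. u x * V i x \<partial>lborel) - tangent_integral u \<gamma> a b $ i\<bar> \<le> (e / ?l) * ?l"
      by (rule exists_mollified_current[OF u \<gamma>]) (rule that)
    have "field_norm V \<le> ?N"
      unfolding field_norm_def using V(3) sum_bounded_above[of UNIV "\<lambda>i. \<integral>x. \<bar>V i x\<bar> \<partial>lborel" ?l] V(2)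
      by (intro add_mono) auto
    then have "\<bar>distribution_of u (V i)\<bar> \<le> D * ?N"
      using len by (intro distribution_of_le_d_norm[OF D V(1)]) (auto simp: add_pos_nonneg)
    then show "\<bar>tangent_integral u \<gamma> a b $ i\<bar> \<le> D * ?N + e"
      using V(4)[of i] len by (simp add: distribution_of_def)
  qed
  \<comment> \<open>The outer factor n comes from bounding the Euclidean norm by the sum of the
    components, the inner one from the n components of the mollified field.\<close>
  then have "(\<Sum>i\<in>UNIV. \<bar>tangent_integral u \<gamma> a b $ i\<bar>) \<le> of_nat (CARD('n)) * (D * ?N)"
    by (intro sum_bounded_above)
  then show ?thesis using norm_le_l1_cart[of "tangent_integral u \<gamma> a b"] by simp
qed

text \<open>The end point term 2 is absent for closed curves and at most twice the length for the
  others, so n length + 2 becomes (n + 2) length in both suprema. The factor 2 in the constant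
  counts the suprema.\<close>

lemma star_norm_le_d_norm:
  fixes u :: "real^'n::{finite,linorder} \<Rightarrow> real" and D :: real
  assumes u: "continuous_on UNIV u" and D: "d_norm (CARD('n) - 1) (distribution_of u) \<le> ennreal D" "0 \<le> D"
  shows "star_norm u \<le> ennreal (2 * CARD('n) * (CARD('n) + 2) * D)"
proof -
  define B where "B = CARD('n) * (CARD('n) + 2) * D"
  have "B \<ge> 0" using D(2) by (simp add: B_def)
  have avg: "curve_average u \<gamma> a b \<le> B"
    if \<gamma>: "smooth_curve \<gamma> a b" and c: "\<gamma> a = \<gamma> b \<or> curve_length \<gamma> a b \<ge> 1" for \<gamma> a b
  proof (cases "curve_length \<gamma> a b > 0")
    case True
    have "norm (tangent_integral u \<gamma> a b) \<le>
        CARD('n) * (D * (CARD('n) * curve_length \<gamma> a b + (if \<gamma> a = \<gamma> b then 0 else 2)))"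
      by (rule tangent_integral_le_d_norm[OF u D \<gamma> True])
    also have "\<dots> \<le> CARD('n) * (D * (CARD('n) * curve_length \<gamma> a b + 2 * curve_length \<gamma> a b))"
      using c True D(2) by (intro mult_left_mono add_left_mono) auto
    also have "\<dots> = B * curve_length \<gamma> a b" by (simp add: B_def algebra_simps)
    finally show ?thesis using True by (simp add: curve_average_def pos_divide_le_eq)
  next
    \<comment> \<open>Positivity of the length is not established: dividing by a nonpositive number,
      with x / 0 = 0, gives at most 0.\<close>
    case False
    then show ?thesis using \<open>B \<ge> 0\<close>
      by (auto simp: curve_average_def intro!: order_trans[OF divide_nonneg_nonpos])
  qed
  have "star_norm u \<le> ennreal B + ennreal B"
    unfolding star_norm_def
  proof (intro add_mono SUP_least; clarify)
    fix \<gamma> :: "real \<Rightarrow> real^'n::{finite,linorder}" and a b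
    assume "smooth_closed_curve \<gamma> a b"
    then have "smooth_curve \<gamma> a b" "\<gamma> a = \<gamma> b"
      unfolding smooth_closed_curve_def by (auto dest: spec[of _ 0])
    then show "ennreal (curve_average u \<gamma> a b) \<le> ennreal B" by (intro ennreal_leI avg) auto
  qed (intro ennreal_leI avg; simp)
  also have "\<dots> = ennreal (B + B)" using \<open>B \<ge> 0\<close> by (simp only: ennreal_plus)
  also have "B + B = 2 * CARD('n) * (CARD('n) + 2) * D" by (simp add: B_def)
  finally show ?thesis .
qed

section \<open>The norm of codimension one bounded by curve averages\<close>

lemma potential_continuous:
  fixes u p :: "real^'n::{finite,linorder} \<Rightarrow> real"
  assumes u: "continuous_on UNIV u"
    and p: "\<And>y w. \<bar>p (y + w) - p y - w $ j * integral {0..1} (\<lambda>\<tau>. u (y + \<tau> *\<^sub>R w))\<bar> \<le> M * norm w"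
  shows "continuous_on UNIV p"
proof (rule continuous_at_imp_continuous_on, rule ballI)
  fix y
  have "bounded (u ` cball y 1)"
    by (intro compact_imp_bounded compact_continuous_image continuous_on_subset[OF u]) auto
  then obtain B where B: "\<And>x. x \<in> cball y 1 \<Longrightarrow> \<bar>u x\<bar> \<le> B" unfolding bounded_iff real_norm_def by blast
  \<comment> \<open>Averages of \<open>u\<close> over segments inside the unit ball around
    \<open>y\<close> are bounded, which gives a Lipschitz estimate at \<open>y\<close>.\<close>
  have "norm (p (y + w) - p y) \<le> (B + M) * norm w" if w: "norm w < 1" for w
  proof -
    let ?J = "integral {0..1} (\<lambda>\<tau>. u (y + \<tau> *\<^sub>R w))"
    have "norm (u (y + \<tau> *\<^sub>R w)) \<le> B" if "\<tau> \<in> {0..1}" for \<tau>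
      unfolding real_norm_def
      using that w by (intro B) (auto simp: dist_norm intro!: mult_le_one)
    then have "norm ?J \<le> B * (1 - 0)"
      by (intro integral_bound continuous_on_compose2[OF u] continuous_intros) auto
    then have "\<bar>w $ j * ?J\<bar> \<le> norm w * B"
      unfolding abs_mult by (intro mult_mono component_le_norm_cart) auto
    then show ?thesis using p[of y w] by (simp add: algebra_simps)
  qed
  then have "\<forall>\<^sub>F w in at 0. norm (p (y + w) - p y) \<le> (B + M) * norm w"
    by (auto simp: eventually_at intro!: exI[of _ 1])
  moreover have "((\<lambda>w. (B + M) * norm w) \<longlongrightarrow> 0) (at (0 :: real^'n::{finite,linorder}))"
    by (auto intro!: tendsto_eq_intros)
  ultimately have "((\<lambda>w. p (y + w) - p y) \<longlongrightarrow> 0) (at 0)"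
    by (rule Lim_null_comparison)
  then show "isCont p y" by (simp add: isCont_iff LIM_zero_iff)
qed

lemma d_norm_le_curve_bound:
  fixes u :: "real^'n::{finite,linorder} \<Rightarrow> real"
  assumes card: "CARD('n) \<ge> 2" and u: "continuous_on UNIV u" and "M \<ge> 0"
    and M: "\<And>\<gamma> a b. smooth_curve \<gamma> a b \<Longrightarrow> curve_length \<gamma> a b \<ge> 1 \<Longrightarrow>
       norm (tangent_integral u \<gamma> a b) \<le> M * curve_length \<gamma> a b"
  shows "d_norm (CARD('n) - 1) (distribution_of u) \<le> ennreal (4 * M)"
proof (rule d_norm_codim_one_leI)
  fix V :: "'n \<Rightarrow> real^'n::{finite,linorder} \<Rightarrow> real" and j
  assume V: "\<And>i. V i \<in> test_functions" and "field_norm V \<le> 1"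
  obtain p :: "real^'n::{finite,linorder} \<Rightarrow> real" where p: "\<And>y. \<bar>p y\<bar> \<le> 4 * M"
    "\<And>y w. \<bar>p (y + w) - p y - w $ j * integral {0..1} (\<lambda>\<tau>. u (y + \<tau> *\<^sub>R w))\<bar> \<le> M * norm w"
    using exists_potential[OF card u M, of j] by blast
  have cp: "continuous_on UNIV p" by (rule potential_continuous[OF u p(2)])
  let ?I = "\<lambda>i. \<integral>x. \<bar>V i x\<bar> \<partial>lborel" and ?div = "\<lambda>x. \<Sum>i\<in>UNIV. partial_deriv i (V i) x"
  have ipV: "integrable lborel (\<lambda>x. w x * partial_deriv i (V i) x)" if "continuous_on UNIV w" for w i
    using partial_deriv_test_function[OF V] test_functionD(3)[OF V] that
    by (intro integrable_continuous_compact_support[of _ "supp (V i)"] continuous_intros) auto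
  \<comment> \<open>One estimate per coordinate direction: along the \<open>j\<close>-th axis
    \<open>p\<close> is an approximate primitive of \<open>u\<close>, along the others of 0. Summing
    over \<open>i\<close> assembles the divergence while \<open>u\<close> is tested only against
    \<open>V j\<close>.\<close>
  have bound: "\<bar>(\<integral>x. p x * partial_deriv i (V i) x \<partial>lborel) +
      (if i = j then distribution_of u (V j) else 0)\<bar> \<le> M * ?I i" for i
  proof -
    have "\<bar>(\<integral>x. p x * partial_deriv i (V i) x \<partial>lborel) +
        (\<integral>x. (if i = j then u x else 0) * V i x \<partial>lborel)\<bar> \<le> M * ?I i"
    proof (rule potential_integral_bound[OF cp _ V])
      show "continuous_on UNIV (\<lambda>x. if i = j then u x else 0)" using u by (cases "i = j") simp_all
      show "\<bar>p (y + h *\<^sub>R axis i 1) - p y -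
          h * integral {0..1} (\<lambda>\<tau>. if i = j then u (y + \<tau> *\<^sub>R (h *\<^sub>R axis i 1)) else 0)\<bar> \<le> M * h"
        if "h > 0" for y h
      proof -
        have "(axis i 1 :: real^'n::{finite,linorder}) $ j = (if i = j then 1 else 0)" by (simp add: axis_def)
        then show ?thesis
          using p(2)[of y "h *\<^sub>R axis i 1"] that by (cases "i = j") (auto simp: norm_axis_1)
      qed
    qed
    then show ?thesis by (cases "i = j") (auto simp: distribution_of_def)
  qed
  have "(\<integral>x. p x * ?div x \<partial>lborel) + distribution_of u (V j) =
      (\<Sum>i\<in>UNIV. (\<integral>x. p x * partial_deriv i (V i) x \<partial>lborel) + (if i = j then distribution_of u (V j) else 0))"
    using ipV[OF cp] by (simp add: sum_distrib_left sum.distrib)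
  also have "\<bar>\<dots>\<bar> \<le> (\<Sum>i\<in>UNIV. M * ?I i)"
    using bound by (intro order_trans[OF sum_abs] sum_mono)
  finally have 1: "\<bar>(\<integral>x. p x * ?div x \<partial>lborel) + distribution_of u (V j)\<bar> \<le> M * (\<Sum>i\<in>UNIV. ?I i)"
    by (simp add: sum_distrib_left)
  have "norm (\<integral>x. p x * ?div x \<partial>lborel) \<le> (\<integral>x. 4 * M * \<bar>?div x\<bar> \<partial>lborel)"
  proof (rule Bochner_Integration.integral_norm_bound_integral)
    show "integrable lborel (\<lambda>x. p x * ?div x)" using ipV[OF cp] by (simp add: sum_distrib_left)
    have "integrable lborel ?div" using ipV[OF continuous_on_const, of 1] by simp
    then show "integrable lborel (\<lambda>x. 4 * M * \<bar>?div x\<bar>)" by auto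
    show "norm (p x * ?div x) \<le> 4 * M * \<bar>?div x\<bar>" for x
      using p(1)[of x] by (auto simp: abs_mult intro!: mult_right_mono)
  qed
  then have "\<bar>distribution_of u (V j)\<bar> \<le> M * (\<Sum>i\<in>UNIV. ?I i) + 4 * M * (\<integral>x. \<bar>?div x\<bar> \<partial>lborel)"
    using 1 by simp
  \<comment> \<open>The factor 4 is forced by the divergence term; the other term has slack.\<close>
  also have "\<dots> \<le> 4 * M * field_norm V"
    using \<open>M \<ge> 0\<close> by (simp add: field_norm_def distrib_left mult_right_mono sum_nonneg)
  also have "\<dots> \<le> 4 * M"
    using \<open>M \<ge> 0\<close> \<open>field_norm V \<le> 1\<close> mult_left_le[of "field_norm V" "4 * M"] by simp
  finally show "\<bar>distribution_of u (V j)\<bar> \<le> 4 * M" .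
qed

lemma d_norm_le_star_norm:
  fixes u :: "real^'n::{finite,linorder} \<Rightarrow> real"
  assumes card: "CARD('n) \<ge> 2" and u: "continuous_on UNIV u"
  shows "d_norm (CARD('n) - 1) (distribution_of u) \<le> ennreal 4 * star_norm u"
proof (cases "star_norm u = \<infinity>")
  case True
  then show ?thesis by (simp add: ennreal_mult_top)
next
  case False
  define S where "S = (SUP (\<gamma>, a, b)\<in>{(\<gamma>, a, b). smooth_curve \<gamma> a b \<and> curve_length \<gamma> a b \<ge> 1}.
       ennreal (curve_average u \<gamma> a b))"
  have le: "S \<le> star_norm u" unfolding star_norm_def S_def by simp
  then have "S < top" using False by (simp add: less_top top_unique)
  then obtain M where M: "S = ennreal M" "M \<ge> 0" by (cases S) auto
  have "norm (tangent_integral u \<gamma> a b) \<le> M * curve_length \<gamma> a b"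
    if "smooth_curve \<gamma> a b" "curve_length \<gamma> a b \<ge> 1" for \<gamma> a b
  proof -
    have "ennreal (curve_average u \<gamma> a b) \<le> ennreal M"
      unfolding M(1)[symmetric] S_def using that by (intro SUP_upper2[of "(\<gamma>, a, b)"]) auto
    then have "curve_average u \<gamma> a b \<le> M" using M(2) by simp
    then show ?thesis using that(2) by (simp add: curve_average_def pos_divide_le_eq)
  qed
  then have "d_norm (CARD('n) - 1) (distribution_of u) \<le> ennreal (4 * M)"
    by (rule d_norm_le_curve_bound[OF card u M(2)])
  also have "\<dots> = ennreal 4 * S" using M by (simp add: ennreal_mult)
  also have "\<dots> \<le> ennreal 4 * star_norm u" using le by (rule mult_left_mono) simp
  finally show ?thesis .
qed

theorem theorem3p14:
  assumes "CARD('n::{finite,linorder}) \<ge> 2"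
  shows "\<exists>c1 c2 :: real. c1 > 0 \<and> c2 > 0 \<and>
    (\<forall>u :: real^'n::{finite,linorder} \<Rightarrow> real.
       continuous_on UNIV u \<and> distribution_of u \<in> d_space (CARD('n) - 1) \<longrightarrow>
         ennreal c1 * star_norm u \<le> d_norm (CARD('n) - 1) (distribution_of u) \<and>
         d_norm (CARD('n) - 1) (distribution_of u) \<le> ennreal c2 * star_norm u)"
proof -
  \<comment> \<open>The constant of \<open>star_norm_le_d_norm\<close>, whose inverse serves as
    \<open>c1\<close>.\<close>
  define C :: real where "C = 2 * CARD('n) * (CARD('n) + 2)"
  have C: "C > 0" unfolding C_def of_nat_0_less_iff using assms by simp
  show ?thesis
  proof (rule exI[of _ "inverse C"], rule exI[of _ 4], intro conjI allI impI)
    fix u :: "real^'n::{finite,linorder} \<Rightarrow> real"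
    assume u: "continuous_on UNIV u \<and> distribution_of u \<in> d_space (CARD('n) - 1)"
    \<comment> \<open>Membership in \<open>d_space\<close> makes the norm finite, so that it can be
      treated as a real number.\<close>
    then obtain D where D: "d_norm (CARD('n) - 1) (distribution_of u) = ennreal D" "D \<ge> 0"
      by (cases "d_norm (CARD('n) - 1) (distribution_of u)") (auto simp: d_space_def)
    have "star_norm u \<le> ennreal (C * D)"
      using star_norm_le_d_norm[of u D] u D by (simp add: C_def)
    then have "ennreal (inverse C) * star_norm u \<le> ennreal (inverse C) * ennreal (C * D)"
      by (rule mult_left_mono) simp
    also have "\<dots> = ennreal D"
      using C D(2) by (simp flip: ennreal_mult)
    finally show "ennreal (inverse C) * star_norm u \<le> d_norm (CARD('n) - 1) (distribution_of u)"
      unfolding D .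
    show "d_norm (CARD('n) - 1) (distribution_of u) \<le> ennreal 4 * star_norm u"
      using d_norm_le_star_norm[OF assms] u by blast
  qed (use C in auto)
qed

end
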